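(* Let $0<l<\infty$, $M>0$. Let $\varphi$ and $\widehat\varphi$ be Weyl functions of two skew-self-adjoint Dirac systems on $[0,l]$ with bounded measurable $m_1\times m_2$ potentials $v$ and $\widehat v$, respectively, where $$\max(\|v(x)\|,\|\widehat v(x)\|)\le M,\qquad 0<x<l.$$ Suppose that on some ray $\Re z=c\,\Im z$ ($c\in\mathbb{R}$, $\Im z>0$) the equality $$\|\varphi(z)-\widehat\varphi(z)\|=O(\mathrm{e}^{2\mathrm{i}rz})\quad(\Im z\to\infty)\quad\text{for all } 0<r<r_0\le l$$ holds. Then $$v(x)=\widehat v(x),\qquad 0<x<r_0$$ (equality of measurable functions, i.e. almost everywhere).
   Context: Let $m_1,m_2$ be positive integers, $m=m_1+m_2$. The skew-self-adjoint Dirac system with potential $v$ (an $m_1\times m_2$ matrix function) is $$\frac{d}{dx}y(x,z)=(\mathrm{i}zj+jV(x))y(x,z),\qquad j=\begin{bmatrix} I_{m_1}&0\\ 0&-I_{m_2}\end{bmatrix},\quad V=\begin{bmatrix}0&v\\ v^*&0\end{bmatrix}.$$ Its fundamental solution $u(x,z)$ is normalized by $u(0,z)=I_m$. $\|\cdot\|$ is the operator norm induced by $\ell^2$-norms. $\mathbb{C}_M=\{z:\Im z>M\}$. $\mathbf{P}_{\ge}(j,\mathbb{C}_M)$: $m\times m_1$ matrix functions $\mathcal{P}$, meromorphic in $\mathbb{C}_M$, with $\mathcal{P}(z)^*\mathcal{P}(z)>0$, $\mathcal{P}(z)^*j\mathcal{P}(z)\ge0$ in $\mathbb{C}_M$ (excluding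 possibly a discrete set). Weyl functions of the system on $[0,l]$ (where $\|v\|\le M$) are the functions, analytic in $\mathbb{C}_M$ (removable singularities removed), $$\varphi(z)=\begin{bmatrix}0&I_{m_2}\end{bmatrix}u(l,z)^{-1}\mathcal{P}(z)\Big(\begin{bmatrix}I_{m_1}&0\end{bmatrix}u(l,z)^{-1}\mathcal{P}(z)\Big)^{-1},\qquad \mathcal{P}\in\mathbf{P}_{\ge}(j,\mathbb{C}_M).$$ $O(\mathrm{e}^{2\mathrm{i}rz})$ denotes a quantity bounded in absolute value by a constant (depending on $r$) times $|\mathrm{e}^{2\mathrm{i}rz}|$ for $z$ on the ray with $\Im z$ large. *)

theory Defs
  imports "HOL-Complex_Analysis.Complex_Analysis"
begin

section \<open>Matrices\<close>

text \<open>A \<^typ>\<open>complex^'m2^'m1\<close> is a matrix with rows indexed by \<^typ>\<open>'m1\<close> and columns by \<^typ>\<open>'m2\<close>,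
  so the sizes \<open>m\<^sub>1\<close>, \<open>m\<^sub>2\<close> are the cardinalities of these (nonempty) index types, and
  \<open>m = m\<^sub>1 + m\<^sub>2\<close> is that of \<^typ>\<open>'m1 + 'm2\<close>.\<close>

definition ctranspose :: "complex^'n^'m \<Rightarrow> complex^'m^'n" where
  "ctranspose A = map_matrix cnj (transpose A)"

definition hform :: "complex^'n^'n \<Rightarrow> complex^'n \<Rightarrow> real" where
  "hform A x = Re (\<Sum>i\<in>UNIV. cnj (x $ i) * (A *v x) $ i)"

definition pos_semidef :: "complex^'n^'n \<Rightarrow> bool" where
  "pos_semidef A \<longleftrightarrow> ctranspose A = A \<and> (\<forall>x. 0 \<le> hform A x)"

definition pos_def :: "complex^'n^'n \<Rightarrow> bool" where
  "pos_def A \<longleftrightarrow> ctranspose A = A \<and> (\<forall>x. x \<noteq> 0 \<longrightarrow> 0 < hform A x)"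

text \<open>The norm of \<^typ>\<open>complex^'n\<close> is the \<open>\<ell>\<^sup>2\<close>-norm, so this is the operator norm used in the
  hypotheses; it is not the library's \<^const>\<open>norm\<close> on matrices, which is the Frobenius norm.\<close>

definition opnorm :: "complex^'n^'m \<Rightarrow> real" where
  "opnorm A = onorm (\<lambda>x. A *v x)"

definition block_mat ::
  "complex^'c^'a \<Rightarrow> complex^'d^'a \<Rightarrow> complex^'c^'b \<Rightarrow> complex^'d^'b \<Rightarrow> complex^('c+'d)^('a+'b)" where
  "block_mat A B C D = (\<chi> i k. case i of
       Inl a \<Rightarrow> (case k of Inl c \<Rightarrow> A $ a $ c | Inr d \<Rightarrow> B $ a $ d)
     | Inr b \<Rightarrow> (case k of Inl c \<Rightarrow> C $ b $ c | Inr d \<Rightarrow> D $ b $ d))"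

definition block_row :: "complex^'c^'a \<Rightarrow> complex^'d^'a \<Rightarrow> complex^('c+'d)^'a" where
  "block_row A B = (\<chi> i k. case k of Inl c \<Rightarrow> A $ i $ c | Inr d \<Rightarrow> B $ i $ d)"

section \<open>The Dirac system\<close>

definition sig_j :: "complex^('m1::finite+'m2::finite)^('m1+'m2)" where
  "sig_j = block_mat (mat 1) 0 0 (- mat 1)"

definition pot_V :: "complex^'m2::finite^'m1::finite \<Rightarrow> complex^('m1+'m2)^('m1+'m2)" where
  "pot_V w = block_mat 0 w (ctranspose w) 0"

definition bounded_measurable_potential :: "real \<Rightarrow> (real \<Rightarrow> complex^'m2::finite^'m1::finite) \<Rightarrow> bool" where
  "bounded_measurable_potential l v \<longleftrightarrow>
     v \<in> borel_measurable (lebesgue_on {0..l}) \<and> bounded (v ` {0..l})"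

text \<open>In the following definition, \<open>D\<close> ranges over the finite families of nonoverlapping closed
  subintervals of \<open>[a,b]\<close>.\<close>

definition abs_cont_on :: "real \<Rightarrow> real \<Rightarrow> (real \<Rightarrow> 'a::real_normed_vector) \<Rightarrow> bool" where
  "abs_cont_on a b f \<longleftrightarrow> (\<forall>\<epsilon>>0. \<exists>\<delta>>0. \<forall>D T.
     D division_of T \<and> T \<subseteq> {a..b} \<and> (\<Sum>K\<in>D. Sup K - Inf K) < \<delta> \<longrightarrow>
     (\<Sum>K\<in>D. norm (f (Sup K) - f (Inf K))) < \<epsilon>)"

text \<open>As the potential is only measurable, solutions are absolutely continuous functions that satisfy
  the equation almost everywhere.\<close>

definition fundamental_solution ::
  "real \<Rightarrow> (real \<Rightarrow> complex^'m2::finite^'m1::finite) \<Rightarrow> complex \<Rightarrow> (real \<Rightarrow> complex^('m1+'m2)^('m1+'m2)) \<Rightarrow> bool" where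
  "fundamental_solution l v z y \<longleftrightarrow>
     abs_cont_on 0 l y \<and> y 0 = mat 1 \<and>
     (AE x in lebesgue_on {0<..<l}.
        (y has_vector_derivative
           (mat (\<i> * z) ** sig_j + sig_j ** pot_V (v x)) ** y x) (at x))"

section \<open>Weyl functions\<close>

definition half_plane :: "real \<Rightarrow> complex set" where
  "half_plane M = {z. Im z > M}"

text \<open>Here and below, the exceptional ``discrete set'' is one without accumulation points in the
  half-plane, as is usual for meromorphic functions; this is what \<^const>\<open>cosparse\<close> expresses.\<close>

definition P_ge :: "real \<Rightarrow> (complex \<Rightarrow> complex^'m1::finite^('m1+'m2::finite)) set" where
  "P_ge M = {P.
     (\<forall>i k. (\<lambda>z. P z $ i $ k) meromorphic_on half_plane M) \<and>
     (\<forall>\<^sub>\<approx>z\<in>half_plane M.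
        pos_def (ctranspose (P z) ** P z) \<and>
        pos_semidef (ctranspose (P z) ** sig_j ** P z))}"

text \<open>The solution \<open>u x z\<close> is uniquely determined for \<open>x\<close> in \<open>[0,l]\<close> and its values are invertible.
  If \<open>\<parallel>v\<parallel> \<le> M\<close>, then the block inverted in the formula is also invertible wherever \<open>P z\<close> satisfies the two
  inequalities in the definition of \<^const>\<open>P_ge\<close>. The formula is only required off a discrete set because of
  the poles and exceptional points of \<open>P\<close>; on that set \<open>\<phi>\<close> is given by analytic continuation.\<close>

definition weyl_function ::
  "real \<Rightarrow> real \<Rightarrow> (real \<Rightarrow> complex^'m2::finite^'m1::finite) \<Rightarrow> (complex \<Rightarrow> complex^'m1^'m2) \<Rightarrow> bool" where
  "weyl_function M l v \<phi> \<longleftrightarrow>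
     (\<forall>i k. (\<lambda>z. \<phi> z $ i $ k) analytic_on half_plane M) \<and>
     (\<exists>u. \<exists>P\<in>P_ge M.
        (\<forall>z\<in>half_plane M. fundamental_solution l v z (\<lambda>x. u x z)) \<and>
        (\<forall>\<^sub>\<approx>z\<in>half_plane M.
           \<phi> z = (block_row 0 (mat 1) ** matrix_inv (u l z) ** P z)
                 ** matrix_inv (block_row (mat 1) 0 ** matrix_inv (u l z) ** P z)))"

end

theory Submission
  imports Defs
begin

text \<open>Let \<open>u\<close> and \<open>u'\<close> be the fundamental solutions for \<open>v\<close> and \<open>v'\<close>. Since \<open>u(x,z\<^sup>*)\<^sup>* u(x,z) = I\<close>,
  they are entire in \<open>z\<close> together with their inverses, and \<open>R(z,x) = u'(x,z) u(x,z)\<^sup>-\<^sup>1\<close> is entire of exponential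
  type and unitary for real \<open>z\<close>. The columns of \<open>u [I; \<phi>]\<close> decay like \<open>exp(izx)\<close>, those of \<open>u [0; I]\<close> grow like
  \<open>exp(-izx)\<close>, and both stay in transversal cones, so \<open>\<phi> - \<phi>' = O(exp(2ixz))\<close> makes \<open>R(z,x)\<close> and \<open>R(z,x)\<^sup>-\<^sup>1\<close>
  bounded on the given ray. As \<open>R(z\<^sup>*,x)\<^sup>* = R(z,x)\<^sup>-\<^sup>1\<close>, \<open>R\<close> is also bounded on the conjugate ray. By
  Phragmen-Lindeloef in the four sectors cut out by the real line and the two rays, and by Liouville, \<open>R(z,x)\<close>
  does not depend on \<open>z\<close>. Comparing the powers of \<open>z\<close> in the differential equation of \<open>R\<close> shows that \<open>R\<close>
  commutes with \<open>j\<close>; its derivative is block off-diagonal, so \<open>R = I\<close> and \<open>v = v'\<close>.\<close>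

subsection \<open>Absolutely continuous functions\<close>

text \<open>The equation holds only almost everywhere, so derivatives are avoided: solutions are
  treated as indefinite integrals of bounded functions (\<open>primitive\<close>), with a product
  rule and Gronwall estimates at that level. The fundamental theorem for \<open>abs_cont_on\<close>
  functions is the bridge from \<open>fundamental_solution\<close> to this setting. A priori R has
  exponential type 2x, and for such functions the Phragmen-Lindeloef principle works only in sectors
  of opening less than pi. A half-plane is too wide, but any ray inside it cuts it into two
  admissible sectors. The given ray lies in the upper half-plane only; the bound for the inverse of
  R there is what controls R on the conjugate ray. The point x itself serves as the exponent r of
  the hypothesis, so constancy in z is proved for each x < r0 separately and all bounds may depend
  on x. The cone of the decaying solutions is |lower| \<le> |upper|, the region where the quadratic
  form of j is nonnegative. For Im z \<ge> M this form decreases along solutions, so the condition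
  on P at l is inherited by all smaller x.\<close>

lemma has_integral_abs_cont_on:
  fixes f :: "real \<Rightarrow> 'a::euclidean_space"
  assumes "a \<le> b" and ac: "abs_cont_on a b f" and N: "negligible N"
    and der: "\<And>x. x \<in> {a..b} - N \<Longrightarrow> (f has_vector_derivative f' x) (at x within {a..b})"
  shows "(f' has_integral f b - f a) {a..b}"
proof -
  \<comment> \<open>Changing the integrand on the negligible set \<open>N\<close> is harmless; with
    the value 0 there, a tag in \<open>N\<close> contributes to the Riemann sum error only the
    increment of f over its interval.\<close>
  define g where "g = (\<lambda>x. if x \<in> N then 0 else f' x)"
  have "(g has_integral f b - f a) (cbox a b)"
    unfolding has_integral
  proof (intro allI impI)
    fix e :: real assume "0 < e"
    define \<epsilon> where "\<epsilon> = e / (2 * (b - a + 1))"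
    have "0 < \<epsilon>" using \<open>0 < e\<close> \<open>a \<le> b\<close> by (simp add: \<epsilon>_def)
    obtain \<delta> where "0 < \<delta>" and \<delta>: "\<And>D T. \<lbrakk>D division_of T; T \<subseteq> {a..b}; (\<Sum>K\<in>D. Sup K - Inf K) < \<delta>\<rbrakk>
        \<Longrightarrow> (\<Sum>K\<in>D. norm (f (Sup K) - f (Inf K))) < e / 2"
      using ac \<open>0 < e\<close> unfolding abs_cont_on_def by (metis half_gt_zero)
    obtain G where "open G" "N \<subseteq> G" and GN: "emeasure lebesgue (G - N) < ennreal \<delta>"
      using sets_lebesgue_outer_open[OF negligible_imp_sets[OF N] \<open>0 < \<delta>\<close>] by metis
    have "G \<in> sets lebesgue" using \<open>open G\<close> by (simp add: borel_open)
    have G: "emeasure lebesgue G < ennreal \<delta>"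
      using GN emeasure_Diff_null_set[OF N[unfolded negligible_iff_null_sets] \<open>G \<in> sets lebesgue\<close>] by simp
    \<comment> \<open>The gauge has two regimes. Intervals tagged in \<open>N\<close> stay inside
      the open set \<open>G\<close> of measure below \<delta>, so absolute continuity bounds their
      increments by e/2 in total. Intervals tagged elsewhere are so short that the linear
      approximation at the tag has relative error \<epsilon>, which also adds up to at most
      e/2.\<close>
    have "\<exists>d>0. (x \<in> N \<longrightarrow> ball x d \<subseteq> G) \<and> (x \<in> {a..b} - N \<longrightarrow> (\<forall>y\<in>{a..b}. norm (y - x) < d \<longrightarrow>
          norm (f y - f x - (y - x) *\<^sub>R f' x) \<le> \<epsilon> * norm (y - x)))" for x
    proof (cases "x \<in> N")
      case True
      then show ?thesis using \<open>open G\<close> \<open>N \<subseteq> G\<close> open_contains_ball by blast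
    next
      case False
      show ?thesis
      proof (cases "x \<in> {a..b}")
        case True
        with False show ?thesis
          using der[unfolded has_vector_derivative_def has_derivative_within_alt, of x] \<open>0 < \<epsilon>\<close> by fastforce
      qed (use False in \<open>auto intro: exI[of _ 1]\<close>)
    qed
    then obtain d where d0: "\<And>x. 0 < d x" and dN: "\<And>x. x \<in> N \<Longrightarrow> ball x (d x) \<subseteq> G"
      and d: "\<And>x y. \<lbrakk>x \<in> {a..b} - N; y \<in> {a..b}; norm (y - x) < d x\<rbrakk> \<Longrightarrow>
          norm (f y - f x - (y - x) *\<^sub>R f' x) \<le> \<epsilon> * norm (y - x)"
      by metis
    show "\<exists>\<gamma>. gauge \<gamma> \<and> (\<forall>p. p tagged_division_of cbox a b \<and> \<gamma> fine p \<longrightarrow>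
            norm ((\<Sum>(x, K)\<in>p. measure lborel K *\<^sub>R g x) - (f b - f a)) < e)"
    proof (intro exI conjI allI impI)
      show "gauge (\<lambda>x. ball x (d x))" using d0 gauge_ball_dependent by blast
      fix p assume "p tagged_division_of cbox a b \<and> (\<lambda>x. ball x (d x)) fine p"
      then have p: "p tagged_division_of cbox a b" and fine: "(\<lambda>x. ball x (d x)) fine p" by auto
      note pD = tagged_division_ofD[OF p]
      define pN where "pN = {(x, K) \<in> p. x \<in> N}"
      have fpN: "finite pN" "pN \<subseteq> p" using pD(1) by (auto simp: pN_def intro: finite_subset)
      define D where "D = snd ` pN"
      have part: "pN tagged_partial_division_of cbox a b"
        using p fpN(2) by (metis tagged_division_of_def tagged_partial_division_subset)
      have tagpN: "pN tagged_division_of \<Union>D"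
        unfolding D_def by (rule tagged_partial_division_of_Union_self[OF part])
      have divD: "D division_of \<Union>D"
        unfolding D_def by (rule partial_division_of_tagged_division[OF part])
      have DG: "\<Union>D \<subseteq> G"
      proof -
        have "K \<subseteq> G" if "(x, K) \<in> pN" for x K
          using that fine dN[of x] by (fastforce simp: pN_def fine_def)
        then show ?thesis by (force simp: D_def)
      qed
      have Dab: "\<Union>D \<subseteq> {a..b}" using pD(3) fpN(2) by (force simp: D_def)
      have Sup_Inf: "K = {Inf K..Sup K} \<and> Inf K \<le> x \<and> x \<le> Sup K \<and> Inf K \<in> {a..b} \<and> Sup K \<in> {a..b}"
        if xK: "(x, K) \<in> p" for x K
      proof -
        obtain u w where uw: "K = cbox u w" using pD(4)[OF xK] by blast
        then show ?thesis using pD(2,3)[OF xK] by auto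
      qed
      have cont: "measure lborel K = Sup K - Inf K" if "(x, K) \<in> p" for x K
        using Sup_Inf[OF that] by (metis content_real order.trans[of "Inf K" x "Sup K"])
      have "ennreal (measure lebesgue (\<Union>D)) < ennreal \<delta>"
        using emeasure_mono[OF DG \<open>G \<in> sets lebesgue\<close>] G lmeasurable_division[OF divD]
        by (metis emeasure_eq_measure2 order.strict_trans1)
      then have "measure lebesgue (\<Union>D) < \<delta>" using ennreal_less_iff[OF measure_nonneg] by blast
      moreover have D_leb: "(\<Sum>K\<in>D. Sup K - Inf K) = (\<Sum>K\<in>D. measure lebesgue K)"
      proof (rule sum.cong)
        fix K assume "K \<in> D"
        then obtain x where xp: "(x, K) \<in> p" using fpN(2) by (auto simp: D_def)
        moreover have "K \<in> sets lborel" using pD(4)[OF xp] by auto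
        ultimately show "Sup K - Inf K = measure lebesgue K" using cont[OF xp] by (simp add: measure_completion)
      qed simp
      ultimately have "(\<Sum>K\<in>D. Sup K - Inf K) < \<delta>"
        using content_division[OF divD] D_leb by simp
      then have "(\<Sum>K\<in>D. norm (f (Sup K) - f (Inf K))) < e / 2"
        using \<delta>[OF divD Dab] by blast
      moreover have "(\<Sum>(x,K)\<in>pN. norm (f (Sup K) - f (Inf K))) = (\<Sum>K\<in>D. norm (f (Sup K) - f (Inf K)))"
      proof -
        \<comment> \<open>\<open>sum.over_tagged_division_lemma\<close> demands the value 0 on every
          interval with empty interior, including the empty set, on which \<open>Sup\<close> and
          \<open>Inf\<close> carry no information.\<close>
        define \<Delta> where "\<Delta> K = (if K = {} then 0 else norm (f (Sup K) - f (Inf K)))" for K :: "real set"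
        have "(\<Sum>(x,K)\<in>pN. \<Delta> K) = sum \<Delta> D"
          unfolding D_def
        proof (rule sum.over_tagged_division_lemma[OF tagpN])
          fix u w :: real assume "box u w = {}"
          then show "\<Delta> (cbox u w) = 0" by (cases "u = w") (auto simp: \<Delta>_def)
        qed
        moreover have ne: "K \<noteq> {}" if "(x, K) \<in> pN" for x K using pD(2) fpN(2) that by blast
        have "(\<Sum>(x,K)\<in>pN. \<Delta> K) = (\<Sum>(x,K)\<in>pN. norm (f (Sup K) - f (Inf K)))"
          using ne by (intro sum.cong) (auto simp: \<Delta>_def)
        moreover have "sum \<Delta> D = (\<Sum>K\<in>D. norm (f (Sup K) - f (Inf K)))"
          using ne by (intro sum.cong) (auto simp: \<Delta>_def D_def)
        ultimately show ?thesis by simp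
      qed
      ultimately have N_part: "(\<Sum>(x,K)\<in>pN. norm (f (Sup K) - f (Inf K))) < e / 2" by simp
      let ?h = "\<lambda>(x,K). measure lborel K *\<^sub>R g x - (f (Sup K) - f (Inf K))"
      have good: "norm (?h (x, K)) \<le> \<epsilon> * (Sup K - Inf K)" if xK: "(x, K) \<in> p - pN" for x K
      proof -
        have xp: "(x, K) \<in> p" and xN: "x \<notin> N" using xK by (auto simp: pN_def)
        note S = Sup_Inf[OF xp]
        let ?u = "Inf K" and ?w = "Sup K"
        have ball: "K \<subseteq> ball x (d x)" using fine xp by (auto simp: fine_def)
        have mem: "?u \<in> K" "?w \<in> K" using S by (metis atLeastAtMost_iff order_refl order_trans)+
        have x: "x \<in> {a..b} - N" using S xN by auto
        \<comment> \<open>Straddle estimate: both end points are compared with the tangent at the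
          tag. As the tag lies between them, the two errors add up to \<epsilon> times the length of
          \<open>K\<close>.\<close>
        have u: "norm (f ?u - f x - (?u - x) *\<^sub>R f' x) \<le> \<epsilon> * norm (?u - x)"
          using S mem ball by (intro d[OF x]) (auto simp: dist_real_def)
        have w: "norm (f ?w - f x - (?w - x) *\<^sub>R f' x) \<le> \<epsilon> * norm (?w - x)"
          using S mem ball by (intro d[OF x]) (auto simp: dist_real_def)
        have h: "?h (x, K) = (f ?u - f x - (?u - x) *\<^sub>R f' x) - (f ?w - f x - (?w - x) *\<^sub>R f' x)"
          using xN by (simp add: g_def cont[OF xp] algebra_simps)
        have "norm (?h (x, K)) \<le> \<epsilon> * norm (?u - x) + \<epsilon> * norm (?w - x)"
          unfolding h by (rule norm_triangle_le_diff[OF add_mono[OF u w]])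
        also have "\<dots> = \<epsilon> * (?w - ?u)" using S by (simp add: algebra_simps)
        finally show ?thesis .
      qed
      have "(\<Sum>(x, K)\<in>p. measure lborel K *\<^sub>R g x) - (f b - f a) = (\<Sum>x\<in>p. ?h x)"
        using additive_tagged_division_1[OF \<open>a \<le> b\<close> p[unfolded cbox_interval], of f]
        by (simp add: sum_subtractf split_def)
      also have "\<dots> = (\<Sum>x\<in>pN. ?h x) + (\<Sum>x\<in>p - pN. ?h x)"
        using sum.subset_diff[OF fpN(2) pD(1)] by (simp add: add.commute)
      finally have eq: "(\<Sum>(x, K)\<in>p. measure lborel K *\<^sub>R g x) - (f b - f a) = (\<Sum>x\<in>pN. ?h x) + (\<Sum>x\<in>p - pN. ?h x)" .
      have "norm (\<Sum>x\<in>pN. ?h x) \<le> (\<Sum>(x,K)\<in>pN. norm (f (Sup K) - f (Inf K)))"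
        by (rule sum_norm_le) (auto simp: pN_def g_def norm_minus_commute)
      moreover have "norm (\<Sum>x\<in>p - pN. ?h x) \<le> (\<Sum>(x,K)\<in>p - pN. \<epsilon> * (Sup K - Inf K))"
        by (rule sum_norm_le) (use good in auto)
      moreover have "(\<Sum>(x,K)\<in>p - pN. \<epsilon> * (Sup K - Inf K)) \<le> (\<Sum>(x,K)\<in>p. \<epsilon> * (Sup K - Inf K))"
        using \<open>0 < \<epsilon>\<close> by (intro sum_mono2) (auto simp: pD(1) intro!: mult_nonneg_nonneg dest!: Sup_Inf)
      moreover have "(\<Sum>(x,K)\<in>p. \<epsilon> * (Sup K - Inf K)) = \<epsilon> * (b - a)"
        using additive_tagged_division_1[OF \<open>a \<le> b\<close> p[unfolded cbox_interval], of "\<lambda>x. x"]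
        by (simp add: case_prod_beta flip: sum_distrib_left)
      moreover have "\<epsilon> * (b - a) \<le> e / 2"
        using \<open>0 < e\<close> \<open>a \<le> b\<close> by (simp add: \<epsilon>_def field_simps)
      ultimately show "norm ((\<Sum>(x, K)\<in>p. measure lborel K *\<^sub>R g x) - (f b - f a)) < e"
        unfolding eq using N_part norm_triangle_ineq[of "\<Sum>x\<in>pN. ?h x" "\<Sum>x\<in>p - pN. ?h x"] by linarith
    qed
  qed
  then show ?thesis
    using has_integral_spike[OF N, of "{a..b}" f' g] by (auto simp: g_def)
qed

lemma abs_cont_on_imp_continuous_on:
  fixes f :: "real \<Rightarrow> 'a::real_normed_vector"
  assumes "abs_cont_on a b f"
  shows "continuous_on {a..b} f"
  unfolding continuous_on_iff
proof (intro ballI allI impI)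
  fix x e :: real assume x: "x \<in> {a..b}" and e: "0 < e"
  obtain d where d: "0 < d" and ac: "\<And>D T. D division_of T \<and> T \<subseteq> {a..b} \<and> (\<Sum>K\<in>D. Sup K - Inf K) < d \<Longrightarrow>
      (\<Sum>K\<in>D. norm (f (Sup K) - f (Inf K))) < e"
    using assms e unfolding abs_cont_on_def by metis
  have *: "norm (f t - f s) < e" if "s \<in> {a..b}" "t \<in> {a..b}" "s \<le> t" "t - s < d" for s t
  proof -
    have "{cbox s t} division_of cbox s t" using that by (intro division_of_self) auto
    then show ?thesis using ac[of "{cbox s t}" "cbox s t"] that by auto
  qed
  show "\<exists>d>0. \<forall>y\<in>{a..b}. dist y x < d \<longrightarrow> dist (f y) (f x) < e"
  proof (intro exI[of _ d] conjI ballI impI d)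
    fix y assume "y \<in> {a..b}" "dist y x < d"
    then show "dist (f y) (f x) < e"
      using *[of x y] *[of y x] x by (cases "x \<le> y") (auto simp: dist_norm norm_minus_commute)
  qed
qed

lemma abs_cont_on_subset: "abs_cont_on a b f \<Longrightarrow> a \<le> c \<Longrightarrow> d \<le> b \<Longrightarrow> abs_cont_on c d f"
  unfolding abs_cont_on_def by (meson atLeastatMost_subset_iff order_trans)

subsection \<open>Indefinite integrals of bounded functions\<close>

text \<open>Stands for "Lipschitz with almost everywhere derivative f". As f is bounded at every
  point and not only almost everywhere, pointwise inequalities for f can be integrated
  directly.\<close>

definition primitive :: "real \<Rightarrow> (real \<Rightarrow> 'a::euclidean_space) \<Rightarrow> (real \<Rightarrow> 'a) \<Rightarrow> bool" where
  "primitive l F f \<longleftrightarrow> bounded (f ` {0..l}) \<and> (\<forall>x\<in>{0..l}. (f has_integral F x - F 0) {0..x})"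

lemma primitive_bounded:
  assumes "primitive l F f"
  obtains B where "0 < B" "\<And>x. x \<in> {0..l} \<Longrightarrow> norm (f x) \<le> B"
  using assms unfolding primitive_def bounded_pos by auto

lemma primitive_has_integral:
  assumes F: "primitive l F f" and "0 \<le> s" "s \<le> t" "t \<le> l"
  shows "(f has_integral F t - F s) {s..t}"
proof -
  have s: "(f has_integral F s - F 0) {0..s}" and t: "(f has_integral F t - F 0) {0..t}"
    using assms by (auto simp: primitive_def)
  have "f integrable_on {s..t}"
    using integrable_on_subinterval[OF has_integral_integrable[OF t]] assms by auto
  then obtain I where I: "(f has_integral I) {s..t}" by blast
  then have "(f has_integral F s - F 0 + I) {0..t}"
    using has_integral_combine[OF \<open>0 \<le> s\<close> \<open>s \<le> t\<close> s I] by blast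
  then have "F s - F 0 + I = F t - F 0" using t has_integral_unique by blast
  then have "I = F t - F s" by (simp add: algebra_simps)
  then show ?thesis using I by simp
qed

lemma primitive_lipschitz:
  assumes F: "primitive l F f" and B: "\<And>x. x \<in> {0..l} \<Longrightarrow> norm (f x) \<le> B"
    and "s \<in> {0..l}" "t \<in> {0..l}"
  shows "norm (F t - F s) \<le> B * \<bar>t - s\<bar>"
proof -
  have *: "norm (F t - F s) \<le> B * \<bar>t - s\<bar>" if "0 \<le> s" "s \<le> t" "t \<le> l" for s t
    using has_integral_bound[of B f "F t - F s" s t] primitive_has_integral[OF F that] B that
      norm_ge_zero[of "f s"] order_trans[OF norm_ge_zero B[of s]]
    by (simp add: cbox_interval)
  show ?thesis
    using *[of s t] *[of t s] assms(3,4) by (cases "s \<le> t") (auto simp: norm_minus_commute abs_minus_commute)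
qed

lemma primitive_continuous:
  assumes "primitive l F f"
  shows "continuous_on {0..l} F"
proof -
  obtain B where B: "0 < B" "\<And>x. x \<in> {0..l} \<Longrightarrow> norm (f x) \<le> B"
    using primitive_bounded[OF assms] by blast
  have "B-lipschitz_on {0..l} F"
    using primitive_lipschitz[OF assms B(2)] B(1)
    by (intro lipschitz_onI) (auto simp: dist_norm norm_minus_commute abs_minus_commute)
  then show ?thesis by (rule lipschitz_on_continuous_on)
qed

lemma primitive_absolutely_integrable:
  assumes "primitive l F f" "0 \<le> l"
  shows "f absolutely_integrable_on {0..l}"
proof -
  obtain B where "\<And>x. x \<in> {0..l} \<Longrightarrow> norm (f x) \<le> B"
    using assms by (metis primitive_bounded)
  moreover have "f integrable_on {0..l}"
    using assms by (auto simp: primitive_def intro: has_integral_integrable)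
  ultimately show ?thesis
    by (intro absolutely_integrable_integrable_bound[where g = "\<lambda>_. B"]) auto
qed

lemma primitive_bounded_linear:
  assumes "bounded_linear h" "primitive l F f"
  shows "primitive l (\<lambda>x. h (F x)) (\<lambda>x. h (f x))"
proof -
  interpret bounded_linear h by fact
  have "(h \<circ> f has_integral h (F x - F 0)) {0..x}" if "x \<in> {0..l}" for x
    using that assms by (intro has_integral_linear) (auto simp: primitive_def)
  moreover have "bounded (h ` f ` {0..l})"
    using assms(2) by (intro bounded_linear_image[OF _ assms(1)]) (simp add: primitive_def)
  ultimately show ?thesis by (simp add: primitive_def diff o_def image_image)
qed

lemma primitive_add:
  assumes "primitive l F f" "primitive l G g"
  shows "primitive l (\<lambda>x. F x + G x) (\<lambda>x. f x + g x)"
proof -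
  have "bounded ((\<lambda>x. f x + g x) ` {0..l})"
    using assms by (intro bounded_plus_comp) (auto simp: primitive_def)
  moreover have "((\<lambda>x. f x + g x) has_integral F x + G x - (F 0 + G 0)) {0..x}" if "x \<in> {0..l}" for x
    using assms that has_integral_add[of f "F x - F 0" "{0..x}" g "G x - G 0"]
    by (simp add: primitive_def algebra_simps)
  ultimately show ?thesis by (simp add: primitive_def)
qed

lemma primitive_diff:
  assumes "primitive l F f" "primitive l G g"
  shows "primitive l (\<lambda>x. F x - G x) (\<lambda>x. f x - g x)"
  using primitive_add[OF assms(1) primitive_bounded_linear[OF bounded_linear_minus[OF bounded_linear_ident] assms(2)]] by simp

lemma primitive_C1:
  assumes "\<And>x. x \<in> {0..l} \<Longrightarrow> (F has_vector_derivative f x) (at x within {0..l})"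
    and "continuous_on {0..l} f"
  shows "primitive l F f"
  unfolding primitive_def
proof (intro conjI ballI)
  show "bounded (f ` {0..l})"
    by (rule compact_imp_bounded[OF compact_continuous_image[OF assms(2) compact_Icc]])
  fix x assume "x \<in> {0..l}"
  then show "(f has_integral F x - F 0) {0..x}"
    by (intro fundamental_theorem_of_calculus)
      (auto intro!: has_vector_derivative_within_subset[OF assms(1)])
qed

lemma primitive_cong:
  assumes "primitive l F f" and "\<And>x. x \<in> {0..l} \<Longrightarrow> F x = G x" "\<And>x. x \<in> {0..l} \<Longrightarrow> f x = g x"
  shows "primitive l G g"
  unfolding primitive_def
proof (intro conjI ballI)
  show "bounded (g ` {0..l})"
    using assms(1) image_cong[OF refl assms(3), of "{0..l}"] by (simp only: primitive_def)
  fix x assume x: "x \<in> {0..l}"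
  then have "(f has_integral F x - F 0) {0..x}" using assms(1) by (simp add: primitive_def)
  moreover have "F x - F 0 = G x - G 0" using assms(2) x by auto
  ultimately show "(g has_integral G x - G 0) {0..x}"
    using has_integral_eq[of "{0..x}" f g "F x - F 0"] assms(3) x by auto
qed

section \<open>Monotonicity, the product rule and Gronwall estimates for indefinite
  integrals\<close>

lemma primitive_antimono:
  fixes F :: "real \<Rightarrow> real"
  assumes F: "primitive l F f" and "\<And>x. x \<in> {0..l} \<Longrightarrow> f x \<le> 0" and "0 \<le> s" "s \<le> t" "t \<le> l"
  shows "F t \<le> F s"
proof -
  have "0 \<le> - (F t - F s)"
    by (rule has_integral_nonneg[OF has_integral_neg[OF primitive_has_integral[OF F assms(3-5)]]])
      (use assms in auto)
  then show ?thesis by simp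
qed

text \<open>Second-order increments force the derivative to exist and vanish at every point, so no
  exceptional null set has to be handled.\<close>

lemma quadratic_increments_imp_const:
  fixes H :: "real \<Rightarrow> 'a::real_normed_vector"
  assumes "\<And>s t. \<lbrakk>0 \<le> s; s \<le> t; t \<le> l\<rbrakk> \<Longrightarrow> norm (H t - H s) \<le> C * (t - s)\<^sup>2" and "x \<in> {0..l}"
  shows "H x = H 0"
proof -
  have *: "norm (H t - H s) \<le> C * \<bar>t - s\<bar> * \<bar>t - s\<bar>" if "s \<in> {0..l}" "t \<in> {0..l}" for s t
    using assms(1)[of s t] assms(1)[of t s] that
    by (cases "s \<le> t") (auto simp: power2_eq_square norm_minus_commute abs_if algebra_simps)
  have "(H has_derivative (\<lambda>h. 0)) (at s within {0..l})" if s: "s \<in> {0..l}" for s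
    unfolding has_derivative_within_alt
  proof (intro conjI allI impI)
    fix e :: real assume "0 < e"
    show "\<exists>d>0. \<forall>y\<in>{0..l}. norm (y - s) < d \<longrightarrow> norm (H y - H s - 0) \<le> e * norm (y - s)"
    proof (intro exI[of _ "e / (\<bar>C\<bar> + 1)"] conjI ballI impI)
      fix y assume y: "y \<in> {0..l}" "norm (y - s) < e / (\<bar>C\<bar> + 1)"
      have "C * \<bar>y - s\<bar> \<le> (\<bar>C\<bar> + 1) * \<bar>y - s\<bar>" by (intro mult_right_mono) auto
      also have "\<dots> \<le> e" using y(2) by (simp add: field_simps)
      finally show "norm (H y - H s - 0) \<le> e * norm (y - s)"
        using order_trans[OF *[OF s y(1)] mult_right_mono[of _ e "\<bar>y - s\<bar>"]] by simp
    qed (use \<open>0 < e\<close> in auto)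
  qed auto
  then obtain c where "\<And>s. s \<in> {0..l} \<Longrightarrow> H s = c"
    using has_derivative_zero_constant[of "{0..l}" H] by auto
  then show ?thesis using assms(2) by auto
qed

lemma bilinear_integrable:
  fixes l :: real and h :: "'a::euclidean_space \<Rightarrow> 'b::euclidean_space \<Rightarrow> 'c::euclidean_space"
  assumes h: "bounded_bilinear h" and f: "f absolutely_integrable_on {0..l}" and G: "continuous_on {0..l} G"
  shows "(\<lambda>x. h (G x) (f x)) absolutely_integrable_on {0..l}"
proof (rule absolutely_integrable_bounded_measurable_product[where h = h])
  show "bilinear h" using h bilinear_conv_bounded_bilinear by blast
  show "bounded (G ` {0..l})"
    by (rule compact_imp_bounded[OF compact_continuous_image[OF G compact_Icc]])
  show "G \<in> borel_measurable (lebesgue_on {0..l})"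
    using G by (rule continuous_imp_measurable_on_sets_lebesgue) (metis fmeasurableD lmeasurable_cbox cbox_interval)
  show "{0..l} \<in> sets lebesgue" by (metis fmeasurableD lmeasurable_cbox cbox_interval)
qed (use f in auto)

text \<open>The product rule without differentiation: \<open>h(F,G)\<close> minus the integral of the claimed derivative has
  increments of second order.\<close>

lemma primitive_bilinear:
  fixes h :: "'a::euclidean_space \<Rightarrow> 'b::euclidean_space \<Rightarrow> 'c::euclidean_space"
  assumes h: "bounded_bilinear h" and F: "primitive l F f" and G: "primitive l G g"
  shows "primitive l (\<lambda>x. h (F x) (G x)) (\<lambda>x. h (f x) (G x) + h (F x) (g x))"
proof (cases "0 \<le> l")
  case False
  then show ?thesis by (simp add: primitive_def)
next
  case True
  interpret bounded_bilinear h by fact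
  obtain B where B: "0 < B" "\<And>x. x \<in> {0..l} \<Longrightarrow> norm (f x) \<le> B" using primitive_bounded[OF F] by blast
  obtain C where C: "0 < C" "\<And>x. x \<in> {0..l} \<Longrightarrow> norm (g x) \<le> C" using primitive_bounded[OF G] by blast
  obtain K where K: "0 < K" "\<And>x y. norm (h x y) \<le> norm x * norm y * K" using pos_bounded by blast
  note hK = order_trans[OF K(2)]
  let ?p = "\<lambda>x. h (f x) (G x) + h (F x) (g x)"
  have contF: "continuous_on {0..l} F" and contG: "continuous_on {0..l} G"
    using F G by (auto intro: primitive_continuous)
  have absf: "f absolutely_integrable_on {0..l}" and absg: "g absolutely_integrable_on {0..l}"
    using F G True by (auto intro: primitive_absolutely_integrable)
  obtain D where D: "0 < D" "\<And>x. x \<in> {0..l} \<Longrightarrow> norm (F x) \<le> D"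
    using compact_imp_bounded[OF compact_continuous_image[OF contF compact_Icc]] unfolding bounded_pos by auto
  obtain E where E: "0 < E" "\<And>x. x \<in> {0..l} \<Longrightarrow> norm (G x) \<le> E"
    using compact_imp_bounded[OF compact_continuous_image[OF contG compact_Icc]] unfolding bounded_pos by auto
  have int: "?p integrable_on {0..l}"
    using bilinear_integrable[OF flip absf contG] bilinear_integrable[OF h absg contF]
    by (intro integrable_add) (auto intro: absolutely_integrable_on_def[THEN iffD1, THEN conjunct1])
  have ints: "?p integrable_on {s..t}" if "0 \<le> s" "t \<le> l" for s t
    using integrable_on_subinterval[OF int] that by auto
  let ?H = "\<lambda>x. h (F x) (G x) - integral {0..x} ?p"
  have H0: "?H x = ?H 0" if "x \<in> {0..l}" for x
  proof (rule quadratic_increments_imp_const[OF _ that])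
    fix s t assume st: "0 \<le> s" "s \<le> t" "t \<le> l"
    have f_st: "(f has_integral F t - F s) {s..t}" and g_st: "(g has_integral G t - G s) {s..t}"
      using primitive_has_integral[OF F st] primitive_has_integral[OF G st] .
    \<comment> \<open>Freezing \<open>G\<close> at the right end and \<open>F\<close> at the left
      end gives an integrand whose integral is exactly h(F t, G t) - h(F s, G s). It differs from
      the true integrand only by terms containing G t - G x and F s - F x, which are of order t -
      s.\<close>
    have 1: "((\<lambda>x. h (f x) (G t) + h (F s) (g x)) has_integral (h (F t - F s) (G t) + h (F s) (G t - G s))) {s..t}"
      using has_integral_linear[OF f_st bounded_linear_left[of "G t"]]
        has_integral_linear[OF g_st bounded_linear_right[of "F s"]]
      by (intro has_integral_add) (auto simp: o_def)
    have 2: "(?p has_integral integral {s..t} ?p) {s..t}"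
      using ints[of s t] st by (intro integrable_integral) auto
    have 3: "((\<lambda>x. h (f x) (G t - G x) + h (F s - F x) (g x)) has_integral (?H t - ?H s)) {s..t}"
    proof -
      have e1: "h (F t - F s) (G t) + h (F s) (G t - G s) - integral {s..t} ?p = ?H t - ?H s"
        using Henstock_Kurzweil_Integration.integral_combine[of 0 s t ?p, OF st(1,2) ints, symmetric] st
        by (simp add: diff_left diff_right)
      have e2: "(\<lambda>x. h (f x) (G t) + h (F s) (g x) - ?p x) = (\<lambda>x. h (f x) (G t - G x) + h (F s - F x) (g x))"
        by (simp add: diff_left diff_right fun_eq_iff)
      show ?thesis
        using has_integral_diff[OF 1 2] unfolding e1 e2 .
    qed
    have "norm (h (f x) (G t - G x) + h (F s - F x) (g x)) \<le> 2 * (B * C * K * (t - s))" if x: "x \<in> {s..t}" for x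
    proof -
      have "norm (h (f x) (G t - G x)) \<le> B * (C * (t - s)) * K"
      proof (intro hK mult_right_mono mult_mono)
        show "norm (G t - G x) \<le> C * (t - s)"
          using x st C(1) by (intro order_trans[OF primitive_lipschitz[OF G C(2), of x t]] mult_left_mono) auto
      qed (use B(1) C(1) K(1) B(2)[of x] C(2)[of x] x st in auto)
      moreover have "norm (h (F s - F x) (g x)) \<le> (B * (t - s)) * C * K"
      proof (intro hK mult_right_mono mult_mono)
        show "norm (F s - F x) \<le> B * (t - s)"
          using x st B(1) by (intro order_trans[OF primitive_lipschitz[OF F B(2), of x s]] mult_left_mono) auto
      qed (use B(1) C(1) K(1) B(2)[of x] C(2)[of x] x st in auto)
      moreover have "B * (C * (t - s)) * K = B * C * K * (t - s)" "(B * (t - s)) * C * K = B * C * K * (t - s)"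
        by (simp_all add: mult_ac)
      ultimately show ?thesis
        using norm_triangle_ineq[of "h (f x) (G t - G x)" "h (F s - F x) (g x)"] by linarith
    qed
    then have "norm (?H t - ?H s) \<le> 2 * B * C * K * (t - s) * (t - s)"
      using has_integral_bound[of "2 * (B * C * K * (t - s))", OF _ 3[unfolded box_real(2)[symmetric]]] B C K st
      by simp
    then show "norm (?H t - ?H s) \<le> (2 * B * C * K) * (t - s)\<^sup>2" by (simp add: power2_eq_square algebra_simps)
  qed
  have "(?p has_integral h (F x) (G x) - h (F 0) (G 0)) {0..x}" if "x \<in> {0..l}" for x
  proof -
    have "integral {0..x} ?p = h (F x) (G x) - h (F 0) (G 0)"
      using H0[OF that] by (simp add: algebra_simps)
    then show ?thesis using integrable_integral[OF ints[of 0 x]] that by simp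
  qed
  moreover have "bounded (?p ` {0..l})"
  proof -
    have "norm (?p x) \<le> B * E * K + D * C * K" if "x \<in> {0..l}" for x
      using B C D E K that
      by (intro norm_triangle_le add_mono hK mult_right_mono mult_mono) auto
    then show ?thesis unfolding bounded_iff by blast
  qed
  ultimately show ?thesis by (simp add: primitive_def)
qed

text \<open>Gronwall's inequality: E(x) exp(-k x) is nonincreasing. Neither k nor E has a prescribed
  sign, so the lower bound that follows is this one applied to -E.\<close>

lemma primitive_exp_bound:
  fixes E :: "real \<Rightarrow> real"
  assumes E: "primitive l E e" and le: "\<And>x. x \<in> {0..l} \<Longrightarrow> e x \<le> k * E x" and st: "0 \<le> s" "s \<le> t" "t \<le> l"
  shows "E t \<le> exp (k * (t - s)) * E s"
proof -
  have "primitive l (\<lambda>x. exp (- k * x)) (\<lambda>x. - k * exp (- k * x))"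
    by (rule primitive_C1) (auto intro!: derivative_eq_intros continuous_intros simp: has_real_derivative_iff_has_vector_derivative[symmetric])
  from primitive_bilinear[OF bounded_bilinear_mult E this]
  have "primitive l (\<lambda>x. E x * exp (- k * x)) (\<lambda>x. e x * exp (- k * x) + E x * (- k * exp (- k * x)))" .
  then have "E t * exp (- k * t) \<le> E s * exp (- k * s)"
  proof (rule primitive_antimono)
    fix x assume "x \<in> {0..l}"
    then show "e x * exp (- k * x) + E x * (- k * exp (- k * x)) \<le> 0"
      using mult_right_mono[OF le, of x "exp (- k * x)"] by (simp add: algebra_simps)
  qed (use st in auto)
  then have "exp (k * t) * (E t * exp (- k * t)) \<le> exp (k * t) * (E s * exp (- k * s))"
    by (intro mult_left_mono) auto
  moreover have "exp (k * t) * (E t * exp (- k * t)) = E t"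
    by (simp add: mult.left_commute flip: exp_add)
  moreover have "exp (k * t) * (E s * exp (- k * s)) = exp (k * (t - s)) * E s"
    by (simp add: right_diff_distrib exp_diff exp_minus field_simps)
  ultimately show ?thesis by metis
qed

lemma primitive_exp_lower_bound:
  fixes E :: "real \<Rightarrow> real"
  assumes E: "primitive l E e" and le: "\<And>x. x \<in> {0..l} \<Longrightarrow> k * E x \<le> e x" and st: "0 \<le> s" "s \<le> t" "t \<le> l"
  shows "exp (k * (t - s)) * E s \<le> E t"
  using primitive_exp_bound[OF primitive_bounded_linear[OF bounded_linear_minus[OF bounded_linear_ident] E], of k s t] le st
  by auto

lemma primitive_inner_self:
  assumes "primitive l F f"
  shows "primitive l (\<lambda>x. F x \<bullet> F x) (\<lambda>x. 2 * (F x \<bullet> f x))"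
  using primitive_bilinear[OF bounded_bilinear_inner assms assms] by (simp add: inner_commute)

text \<open>Picard iteration in the form of a Neumann series: its n-th term is bounded by |y0| (K
  x)^n / n!, so the series converges uniformly and its sum solves the integral equation. Only
  boundedness and measurability of the coefficient enter.\<close>

lemma volterra_exists:
  fixes h :: "'b::euclidean_space \<Rightarrow> 'a::euclidean_space \<Rightarrow> 'a" and l :: real
  assumes h: "bounded_bilinear h" and A: "A \<in> borel_measurable (lebesgue_on {0..l})" "bounded (A ` {0..l})"
    and l: "0 \<le> l"
  shows "\<exists>Y. Y 0 = y0 \<and> primitive l Y (\<lambda>x. h (A x) (Y x))"
proof -
  interpret bounded_bilinear h by fact
  obtain B where B: "0 < B" "\<And>x. x \<in> {0..l} \<Longrightarrow> norm (A x) \<le> B" using A(2) unfolding bounded_pos by auto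
  obtain C where C: "0 < C" "\<And>x y. norm (h x y) \<le> norm x * norm y * C" using pos_bounded by blast
  define K where "K = B * C"
  have "0 < K" using B C by (simp add: K_def)
  have K: "norm (h (A x) y) \<le> K * norm y" if "x \<in> {0..l}" for x y
  proof -
    have "norm (A x) * norm y * C \<le> B * norm y * C"
      using B(2)[OF that] C(1) by (intro mult_right_mono) auto
    then show ?thesis using C(2)[of "A x" y] by (simp add: K_def mult_ac)
  qed
  have A_int: "A absolutely_integrable_on {0..l}"
  proof (rule measurable_bounded_by_integrable_imp_absolutely_integrable[OF A(1)])
    show "{0..l} \<in> sets lebesgue" by (metis fmeasurableD lmeasurable_cbox cbox_interval)
    show "(\<lambda>x. B) integrable_on {0..l}" by (simp add: integrable_const_ivl)
  qed (use B in auto)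
  have hA_int: "(\<lambda>t. h (A t) (G t)) integrable_on {0..x}" if "continuous_on {0..l} G" "x \<in> {0..l}" for G x
  proof -
    have "(\<lambda>t. h (A t) (G t)) integrable_on {0..l}"
      using bilinear_integrable[OF flip A_int that(1)] set_lebesgue_integral_eq_integral(1) by blast
    then show ?thesis by (rule integrable_on_subinterval) (use that in auto)
  qed
  have prim: "primitive l (\<lambda>x. c + integral {0..x} (\<lambda>t. h (A t) (G t))) (\<lambda>t. h (A t) (G t))"
    if G: "continuous_on {0..l} G" for c G
    unfolding primitive_def
  proof (intro conjI ballI)
    obtain D where D: "\<And>x. x \<in> {0..l} \<Longrightarrow> norm (G x) \<le> D"
      using compact_imp_bounded[OF compact_continuous_image[OF G compact_Icc]] unfolding bounded_iff by (metis imageI)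
    have "norm (h (A x) (G x)) \<le> K * D" if "x \<in> {0..l}" for x
      using order_trans[OF K[OF that] mult_left_mono[OF D[OF that]]] \<open>0 < K\<close> by auto
    then show "bounded ((\<lambda>t. h (A t) (G t)) ` {0..l})" unfolding bounded_iff by blast
    fix x assume "x \<in> {0..l}"
    then show "((\<lambda>t. h (A t) (G t)) has_integral c + integral {0..x} (\<lambda>t. h (A t) (G t)) -
        (c + integral {0..0} (\<lambda>t. h (A t) (G t)))) {0..x}"
      using integrable_integral[OF hA_int[OF G]] by simp
  qed
  \<comment> \<open>These are the terms of the series, not the iterates; the iterates are the
    partial sums \<open>S\<close>. The summand 0 makes each term an instance of
    \<open>prim\<close>.\<close>
  define D where "D = rec_nat (\<lambda>_. y0) (\<lambda>n G x. 0 + integral {0..x} (\<lambda>t. h (A t) (G t)))"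
  have D0: "D 0 = (\<lambda>_. y0)" and DS: "D (Suc n) = (\<lambda>x. 0 + integral {0..x} (\<lambda>t. h (A t) (D n t)))" for n
    by (simp_all add: D_def)
  have contD: "continuous_on {0..l} (D n)" for n
  proof (induction n)
    case (Suc n)
    then show ?case using primitive_continuous[OF prim] unfolding DS by blast
  qed (simp add: D0)
  have boundD: "norm (D n x) \<le> norm y0 * (K * x) ^ n / fact n" if "x \<in> {0..l}" for n x
    using that
  proof (induction n arbitrary: x)
    case (Suc n)
    have 1: "((\<lambda>t. K * (norm y0 * (K * t) ^ n / fact n)) has_integral
        norm y0 * (K * x) ^ Suc n / fact (Suc n) - norm y0 * (K * 0) ^ Suc n / fact (Suc n)) {0..x}"
    proof (rule fundamental_theorem_of_calculus)
      fix t assume "t \<in> {0..x}"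
      have "((\<lambda>t. norm y0 * (K * t) ^ Suc n / fact (Suc n)) has_real_derivative
          norm y0 * (real (Suc n) * (K * t) ^ n * K) / fact (Suc n)) (at t within {0..x})"
        by (auto intro!: derivative_eq_intros simp del: fact_Suc power_Suc)
      also have "norm y0 * (real (Suc n) * (K * t) ^ n * K) / fact (Suc n) = K * (norm y0 * (K * t) ^ n / fact n)"
        by (simp add: divide_simps)
      finally show "((\<lambda>t. norm y0 * (K * t) ^ Suc n / fact (Suc n)) has_vector_derivative
          K * (norm y0 * (K * t) ^ n / fact n)) (at t within {0..x})"
        by (simp only: has_real_derivative_iff_has_vector_derivative)
    qed (use Suc.prems in auto)
    have 2: "norm (h (A t) (D n t)) \<le> K * (norm y0 * (K * t) ^ n / fact n)" if "t \<in> {0..x}" for t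
      using that Suc.prems \<open>0 < K\<close> by (intro order_trans[OF K] mult_left_mono Suc.IH) auto
    show ?case
      using integral_norm_bound_integral[OF hA_int[OF contD Suc.prems] has_integral_integrable[OF 1] 2]
      unfolding integral_unique[OF 1] by (simp add: DS del: fact_Suc)
  qed (simp add: D0)
  define S where "S n x = (\<Sum>i<n. D i x)" for n x
  define Y where "Y x = (\<Sum>i. D i x)" for x
  have unif: "uniform_limit {0..l} S Y sequentially"
    unfolding S_def Y_def
  proof (rule Weierstrass_m_test)
    show "norm (D n x) \<le> norm y0 * ((K * l) ^ n / fact n)" if "x \<in> {0..l}" for n x
    proof -
      have "norm y0 * ((K * x) ^ n / fact n) \<le> norm y0 * ((K * l) ^ n / fact n)"
        using that \<open>0 < K\<close> by (intro mult_left_mono divide_right_mono power_mono) auto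
      then show ?thesis using boundD[OF that, of n] by simp
    qed
    show "summable (\<lambda>n. norm y0 * ((K * l) ^ n / fact n))"
      using summable_exp[of "K * l"] by (intro summable_mult) (simp add: field_simps)
  qed
  have contS: "continuous_on {0..l} (S n)" for n
    unfolding S_def by (intro continuous_intros contD)
  have contY: "continuous_on {0..l} Y"
    by (rule uniform_limit_theorem[OF _ unif]) (auto simp: contS)
  have S_Suc: "S (Suc n) x = y0 + integral {0..x} (\<lambda>t. h (A t) (S n t))" if "x \<in> {0..l}" for n x
  proof -
    have "S (Suc n) x = y0 + (\<Sum>i<n. integral {0..x} (\<lambda>t. h (A t) (D i t)))"
      unfolding S_def by (subst sum.lessThan_Suc_shift) (simp add: D0 DS)
    also have "(\<Sum>i<n. integral {0..x} (\<lambda>t. h (A t) (D i t))) = integral {0..x} (\<lambda>t. h (A t) (S n t))"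
      unfolding S_def sum_right by (rule integral_sum[symmetric]) (auto intro: hA_int contD that)
    finally show ?thesis .
  qed
  have Y_eq: "Y x = y0 + integral {0..x} (\<lambda>t. h (A t) (Y t))" if x: "x \<in> {0..l}" for x
  proof -
    let ?I = "integral {0..x} (\<lambda>t. h (A t) (Y t))"
    \<comment> \<open>Both sides are compared with \<open>S (Suc n) x\<close>: uniform convergence
      puts it within e of \<open>Y x\<close>, and within K e l of the right-hand side by
      \<open>S_Suc\<close>.\<close>
    have "norm (Y x - (y0 + ?I)) \<le> e * (1 + K * l)" if "0 < e" for e
    proof -
      obtain n where n: "\<And>m t. n \<le> m \<Longrightarrow> t \<in> {0..l} \<Longrightarrow> norm (S m t - Y t) < e"
        using uniform_limitD[OF unif \<open>0 < e\<close>] unfolding eventually_sequentially dist_norm by blast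
      have "((\<lambda>t. h (A t) (S n t) - h (A t) (Y t)) has_integral (integral {0..x} (\<lambda>t. h (A t) (S n t)) - ?I)) (cbox 0 x)"
        using x contS contY by (auto intro!: has_integral_diff integrable_integral hA_int)
      then have "norm (integral {0..x} (\<lambda>t. h (A t) (S n t)) - ?I) \<le> (K * e) * measure lborel (cbox 0 x)"
      proof (rule has_integral_bound[rotated])
        fix t assume t: "t \<in> cbox 0 x"
        have "norm (h (A t) (S n t - Y t)) \<le> K * norm (S n t - Y t)" using t x by (intro K) auto
        also have "\<dots> \<le> K * e" using n[of n t] t x \<open>0 < K\<close> by (intro mult_left_mono) auto
        finally show "norm (h (A t) (S n t) - h (A t) (Y t)) \<le> K * e" by (simp add: diff_right)
      qed (use \<open>0 < K\<close> \<open>0 < e\<close> in auto)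
      also have "\<dots> \<le> (K * e) * l" using x \<open>0 < K\<close> \<open>0 < e\<close> by (intro mult_left_mono) auto
      finally have "norm (S (Suc n) x - (y0 + ?I)) \<le> K * e * l" by (simp add: S_Suc[OF x])
      moreover have "norm (Y x - S (Suc n) x) \<le> e" using n[of "Suc n" x] x by (simp add: norm_minus_commute)
      ultimately have "norm ((Y x - S (Suc n) x) + (S (Suc n) x - (y0 + ?I))) \<le> e + K * e * l"
        by (intro norm_triangle_le) auto
      then show ?thesis by (simp add: algebra_simps)
    qed
    note bd = this
    have pos: "0 < 1 + K * l" using \<open>0 < K\<close> l by (simp add: add_pos_nonneg)
    have "norm (Y x - (y0 + ?I)) \<le> 0 + d" if "0 < d" for d
      using bd[of "d / (1 + K * l)"] pos that by simp
    then have "norm (Y x - (y0 + ?I)) \<le> 0" using field_le_epsilon by blast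
    then show ?thesis by simp
  qed
  have "primitive l Y (\<lambda>x. h (A x) (Y x))"
    by (rule primitive_cong[OF prim[OF contY, of y0]]) (simp_all add: Y_eq)
  moreover have "Y 0 = y0" using Y_eq[of 0] l by simp
  ultimately show ?thesis by blast
qed

text \<open>Lebesgue differentiation on each {0..b} with b < l. The point l is left out because the
  integrals are controlled only for x < l; a countable union over b tending to l covers the open
  interval.\<close>

lemma has_integral_0_imp_negligible:
  fixes f :: "real \<Rightarrow> 'a::euclidean_space"
  assumes f: "\<And>x. x \<in> {0..<l} \<Longrightarrow> (f has_integral 0) {0..x}"
  obtains N where "negligible N" "\<And>x. x \<in> {0<..<l} - N \<Longrightarrow> f x = 0"
proof -
  have *: "\<exists>N. negligible N \<and> (\<forall>x\<in>{0<..<b} - N. f x = 0)" if b: "0 \<le> b" "b < l" for b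
  proof -
    \<comment> \<open>The differentiation theorem used here asks for integrability on every interval
      of the line, hence the extension by 0.\<close>
    define g where "g x = (if x \<in> {0..b} then f x else 0)" for x
    have sub: "(f has_integral 0) {s..t}" if "0 \<le> s" "s \<le> t" "t \<le> b" for s t
    proof -
      have "f integrable_on {s..t}"
        by (rule integrable_on_subinterval[OF has_integral_integrable[OF f[of b]]]) (use that b in auto)
      then obtain I where I: "(f has_integral I) {s..t}" by blast
      have "(f has_integral 0 + I) {0..t}"
        by (rule has_integral_combine[OF _ _ f I]) (use that b in auto)
      moreover have "(f has_integral 0) {0..t}" by (rule f) (use that b in auto)
      ultimately have "0 + I = 0" by (rule has_integral_unique)
      then show ?thesis using I by simp
    qed
    have "g integrable_on cbox s t" for s t
    proof -
      have "f integrable_on {max 0 s..min b t}"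
        using sub[of "max 0 s" "min b t"] by (cases "max 0 s \<le> min b t") (auto simp: integrable_on_def)
      then have "(\<lambda>x. if x \<in> {0..b} then f x else 0) integrable_on {s..t}"
        by (subst integrable_restrict_Int) (simp add: Int_atLeastAtMost max.commute)
      then show ?thesis by (simp add: g_def[abs_def])
    qed
    from integrable_ccontinuous_explicit[OF this] obtain N where N: "negligible N"
      and lim: "\<And>x e. \<lbrakk>x \<notin> N; 0 < e\<rbrakk> \<Longrightarrow> \<exists>d>0. \<forall>h. 0 < h \<and> h < d \<longrightarrow>
          norm (integral (cbox x (x + h *\<^sub>R One)) g /\<^sub>R h ^ DIM(real) - g x) < e" by blast
    have "f x = 0" if x: "x \<in> {0<..<b} - N" for x
    proof (rule ccontr)
      assume "f x \<noteq> 0"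
      then obtain d where d: "0 < d" "\<And>h. 0 < h \<and> h < d \<Longrightarrow>
          norm (integral (cbox x (x + h *\<^sub>R One)) g /\<^sub>R h ^ DIM(real) - g x) < norm (f x)"
        using lim[of x "norm (f x)"] x by auto
      \<comment> \<open>The averages of g over intervals to the right of x vanish while they stay
        inside {0..b}, yet for length below d they must lie within |f x| of the nonzero value f
        x.\<close>
      define h where "h = min (d / 2) (b - x)"
      have h: "0 < h" "h < d" "x + h \<le> b" using d(1) x by (auto simp: h_def)
      have "(g has_integral 0) {x..x + h}"
        using has_integral_eq[OF _ sub[of x "x + h"], of g] x h by (auto simp: g_def)
      then have "integral {x..x + h} g = 0" by (rule integral_unique)
      then show False using d(2)[of h] h x by (simp add: g_def)
    qed
    then show ?thesis using N by blast
  qed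
  have "\<exists>N. negligible N \<and> (\<forall>x\<in>{0<..<l - l / real (Suc n)} - N. f x = 0)" for n
  proof (cases "0 \<le> l")
    case True
    then have "l / real (Suc n) \<le> l" by (simp add: field_simps)
    then show ?thesis
      using *[of "l - l / real (Suc n)"] True by (cases "l = 0") auto
  next
    case False
    then have "{0<..<l - l / real (Suc n)} = {}" by (auto simp: field_simps mult_nonpos_nonneg)
    then show ?thesis by auto
  qed
  then obtain N where N: "\<And>n. negligible (N n)" "\<And>n x. x \<in> {0<..<l - l / real (Suc n)} - N n \<Longrightarrow> f x = 0"
    by metis
  show thesis
  proof
    show "negligible (\<Union>n. N n)" using N(1) by (intro negligible_countable_Union) auto
    fix x assume x: "x \<in> {0<..<l} - (\<Union>n. N n)"
    have "(\<lambda>n. l - l / real (Suc n)) \<longlonglongrightarrow> l - 0"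
      by (intro tendsto_intros LIMSEQ_Suc[OF lim_const_over_n])
    then have "eventually (\<lambda>n. x < l - l / real (Suc n)) sequentially"
      using x by (intro order_tendstoD) auto
    then obtain n where "x < l - l / real (Suc n)" by (auto simp: eventually_sequentially)
    then show "f x = 0" using N(2)[of x n] x by auto
  qed
qed

lemma continuous_has_integral_0:
  fixes f :: "real \<Rightarrow> 'a::euclidean_space"
  assumes f: "continuous_on {0..b} f" and "0 < b" and int: "\<And>x. x \<in> {0..b} \<Longrightarrow> (f has_integral 0) {0..x}"
    and x: "x \<in> {0..b}"
  shows "f x = 0"
proof -
  have "((\<lambda>u. integral {0..u} f) has_vector_derivative f x) (at x within {0..b})"
    by (rule integral_has_vector_derivative[OF f x])
  then have "((\<lambda>u. 0) has_vector_derivative f x) (at x within {0..b})"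
    by (rule has_vector_derivative_transform[OF x, rotated]) (use int in \<open>auto intro: integral_unique\<close>)
  then show ?thesis
    using vector_derivative_unique_within_closed_interval[of 0 b x "\<lambda>u. 0" "f x" 0] \<open>0 < b\<close> x by auto
qed

subsection \<open>The Phragmen-Lindeloef principle\<close>

text \<open>The function is damped by exp(-e q(w)) with q(w) = 2 cosh(\<beta> w). On the strip Re q
  is at least a positive multiple of exp(\<beta> |Re w|), and \<beta> > 1 makes this beat the
  allowed growth B exp(Re w). The maximum principle on a long rectangle gives the bound K for every
  e > 0, and e tends to 0.\<close>

lemma phragmen_lindelof_strip:
  assumes f: "f holomorphic_on UNIV" and h: "0 < h" "h < pi / 2" and K: "0 < K" and C: "0 < C" "0 \<le> B"
    and growth: "\<And>w. \<bar>Im w\<bar> \<le> h \<Longrightarrow> norm (f w) \<le> C * exp (B * exp (Re w))"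
    and boundary: "\<And>w. \<bar>Im w\<bar> = h \<Longrightarrow> norm (f w) \<le> K"
    and w0: "\<bar>Im w0\<bar> \<le> h"
  shows "norm (f w0) \<le> K"
proof -
  \<comment> \<open>The midpoint of 1 and pi/(2h): above 1 to beat the growth, below pi/(2h) to keep
    cos(\<beta> Im w) positive on the strip.\<close>
  define \<beta> where "\<beta> = (1 + pi / (2 * h)) / 2"
  have \<beta>: "1 < \<beta>" "\<beta> * h < pi / 2" using h by (auto simp: \<beta>_def field_simps)
  define q :: "complex \<Rightarrow> complex" where "q w = exp (of_real \<beta> * w) + exp (- (of_real \<beta> * w))" for w
  define c where "c = cos (\<beta> * h)"
  have "0 < c" unfolding c_def using h \<beta> by (intro cos_gt_zero_pi) (auto intro: less_trans[of _ 0])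
  have Re_q: "c * (exp (\<beta> * Re w) + exp (- (\<beta> * Re w))) \<le> Re (q w)" if "\<bar>Im w\<bar> \<le> h" for w
  proof -
    have "\<bar>\<beta> * Im w\<bar> \<le> \<beta> * h" using that \<beta>(1) by (simp add: abs_mult)
    then have "c \<le> cos (\<beta> * Im w)"
      unfolding c_def using \<beta>(2) cos_mono_le_eq[of "\<beta> * h" "\<bar>\<beta> * Im w\<bar>"] h \<beta>(1) by simp
    moreover have "Re (q w) = cos (\<beta> * Im w) * (exp (\<beta> * Re w) + exp (- (\<beta> * Re w)))"
      by (simp add: q_def Re_exp algebra_simps)
    ultimately show ?thesis by (metis mult_right_mono add_nonneg_nonneg exp_ge_zero)
  qed
  have main: "norm (f w0 * exp (- (of_real e * q w0))) \<le> K" if "0 < e" for e :: real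
  proof -
    let ?g = "\<lambda>w. f w * exp (- (of_real e * q w))"
    have norm_exp: "norm (exp (- (of_real e * q w))) = exp (- (e * Re (q w)))" for w by simp
    have "filterlim (\<lambda>X. exp ((\<beta> - 1) * X)) at_top at_top"
      by (intro filterlim_compose[OF exp_at_top] filterlim_tendsto_pos_mult_at_top[OF tendsto_const] filterlim_ident) (use \<beta> in auto)
    then have "eventually (\<lambda>X. (B + 1) / (e * c) \<le> exp ((\<beta> - 1) * X)) at_top"
      by (simp add: filterlim_at_top)
    moreover have "eventually (\<lambda>X. ln (C / K) \<le> exp X) at_top"
      using exp_at_top by (simp add: filterlim_at_top)
    ultimately have "eventually (\<lambda>X. (B + 1) / (e * c) \<le> exp ((\<beta> - 1) * X) \<and> ln (C / K) \<le> exp X \<and> \<bar>Re w0\<bar> + 1 \<le> X) at_top"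
      by (intro eventually_conj eventually_ge_at_top)
    \<comment> \<open>The first condition, with B + 1 in place of B, leaves a spare factor exp(-exp
      X); the second makes this factor small enough to turn C into K; the third puts w0 inside the
      rectangle.\<close>
    then obtain X where X: "(B + 1) / (e * c) \<le> exp ((\<beta> - 1) * X)" "ln (C / K) \<le> exp X" "\<bar>Re w0\<bar> + 1 \<le> X"
      using eventually_happens trivial_limit_at_top_linorder by blast
    have "B + 1 \<le> e * c * exp ((\<beta> - 1) * X)" using X(1) \<open>0 < e\<close> \<open>0 < c\<close> by (simp add: field_simps)
    then have "(B + 1) * exp X \<le> e * c * exp ((\<beta> - 1) * X) * exp X" by (intro mult_right_mono) auto
    also have "\<dots> = e * c * exp (\<beta> * X)" by (simp add: mult.assoc left_diff_distrib flip: exp_add)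
    finally have X1: "B * exp X - e * c * exp (\<beta> * X) \<le> - exp X" by (simp add: algebra_simps)
    have side: "norm (?g w) \<le> K" if w: "\<bar>Re w\<bar> = X" "\<bar>Im w\<bar> \<le> h" for w
    proof -
      have "exp (\<beta> * X) \<le> exp (\<beta> * Re w) + exp (- (\<beta> * Re w))"
        using w(1) by (cases "0 \<le> Re w") (auto simp: abs_if)
      then have "c * exp (\<beta> * X) \<le> Re (q w)"
        using Re_q[OF w(2)] \<open>0 < c\<close> by (meson mult_le_cancel_left_pos order_trans)
      then have 1: "exp (- (e * Re (q w))) \<le> exp (- (e * c * exp (\<beta> * X)))"
        using \<open>0 < e\<close> by (simp add: mult.assoc)
      have "norm (f w) \<le> C * exp (B * exp (Re w))" by (rule growth[OF w(2)])
      also have "\<dots> \<le> C * exp (B * exp X)" using w(1) C by (auto intro!: mult_left_mono)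
      finally have "norm (?g w) \<le> C * exp (B * exp X) * exp (- (e * c * exp (\<beta> * X)))"
        unfolding norm_mult norm_exp using 1 C by (intro mult_mono) auto
      also have "\<dots> = C * exp (B * exp X - e * c * exp (\<beta> * X))" by (simp add: exp_diff exp_minus field_simps)
      also have "\<dots> \<le> C * exp (- ln (C / K))" using X1 X(2) C by (intro mult_left_mono) auto
      also have "\<dots> = K" using C K by (simp add: exp_minus)
      finally show ?thesis .
    qed
    have lid: "norm (?g w) \<le> K" if w: "\<bar>Im w\<bar> = h" for w
    proof -
      have "0 \<le> Re (q w)"
        using Re_q[of w] w \<open>0 < c\<close> by (smt (verit) exp_gt_zero mult_pos_pos)
      then have "norm (?g w) \<le> K * 1"
        unfolding norm_mult norm_exp using boundary[OF w] \<open>0 < e\<close> K by (intro mult_mono) auto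
      then show ?thesis by simp
    qed
    let ?S = "cbox (Complex (- X) (- h)) (Complex X h)"
    have "norm (?g w0) \<le> K"
    proof (rule maximum_modulus_frontier[of ?g ?S])
      have hol: "?g holomorphic_on UNIV" unfolding q_def by (intro holomorphic_intros f)
      then show "?g holomorphic_on interior ?S" by (rule holomorphic_on_subset) auto
      show "continuous_on (closure ?S) ?g"
        using holomorphic_on_imp_continuous_on[OF hol] continuous_on_subset by blast
      show "w0 \<in> ?S" using w0 X(3) by (auto simp: in_cbox_complex_iff)
      fix w assume "w \<in> frontier ?S"
      then have "w \<in> ?S" "w \<notin> box (Complex (- X) (- h)) (Complex X h)"
        by (simp_all add: frontier_def)
      then have "\<bar>Re w\<bar> = X \<and> \<bar>Im w\<bar> \<le> h \<or> \<bar>Im w\<bar> = h"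
        by (auto simp: in_cbox_complex_iff in_box_complex_iff)
      then show "norm (?g w) \<le> K" using side lid by blast
    qed simp
    then show ?thesis .
  qed
  have "((\<lambda>e::real. norm (f w0 * exp (- (of_real e * q w0)))) \<longlongrightarrow> norm (f w0 * exp (- (of_real 0 * q w0)))) (at_right 0)"
    by (intro tendsto_intros)
  then have "norm (f w0 * exp (- (of_real 0 * q w0))) \<le> K"
    by (rule tendsto_upperbound) (auto simp: eventually_at_right_less main intro: eventually_mono[OF eventually_at_right_less])
  then show ?thesis by simp
qed

text \<open>The map w to exp(w + i\<gamma>), with \<gamma> the bisecting angle, takes the strip of
  half-width h onto the sector and exponential growth in |z| into exp(B exp(Re w)). An opening below
  pi is exactly h < pi/2.\<close>

lemma phragmen_lindelof_sector:
  assumes f: "f holomorphic_on UNIV" and K: "0 < K" and C: "0 < C" "0 \<le> B"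
    and growth: "\<And>z. norm (f z) \<le> C * exp (B * norm z)"
    and \<alpha>: "\<alpha>1 < \<alpha>2" "\<alpha>2 - \<alpha>1 < pi"
    and boundary: "\<And>r. 0 < r \<Longrightarrow> norm (f (rcis r \<alpha>1)) \<le> K" "\<And>r. 0 < r \<Longrightarrow> norm (f (rcis r \<alpha>2)) \<le> K"
    and \<theta>: "\<alpha>1 \<le> \<theta>" "\<theta> \<le> \<alpha>2" and r: "0 < r"
  shows "norm (f (rcis r \<theta>)) \<le> K"
proof -
  define \<gamma> where "\<gamma> = (\<alpha>1 + \<alpha>2) / 2"
  define h where "h = (\<alpha>2 - \<alpha>1) / 2"
  let ?e = "\<lambda>w. exp (w + \<i> * of_real \<gamma>)"
  have e: "?e w = rcis (exp (Re w)) (Im w + \<gamma>)" for w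
    by (simp add: exp_eq_polar rcis_def)
  have "norm ((\<lambda>w. f (?e w)) (Complex (ln r) (\<theta> - \<gamma>))) \<le> K"
  proof (rule phragmen_lindelof_strip[where f = "\<lambda>w. f (?e w)" and h = h and C = C and B = B])
    show "(\<lambda>w. f (?e w)) holomorphic_on UNIV"
      by (rule holomorphic_on_compose_gen[OF _ f, of ?e UNIV, unfolded o_def]) (auto intro!: holomorphic_intros)
    show "norm (f (?e w)) \<le> C * exp (B * exp (Re w))" for w
      using growth[of "?e w"] by simp
    show "norm (f (?e w)) \<le> K" if "\<bar>Im w\<bar> = h" for w
    proof -
      have "Im w + \<gamma> = \<alpha>1 \<or> Im w + \<gamma> = \<alpha>2" using that by (auto simp: \<gamma>_def h_def abs_if field_simps split: if_splits)
      then show ?thesis unfolding e using boundary by auto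
    qed
    show "\<bar>Im (Complex (ln r) (\<theta> - \<gamma>))\<bar> \<le> h"
      using \<theta> by (simp add: \<gamma>_def h_def abs_le_iff field_simps)
  qed (use \<alpha> K C in \<open>auto simp: h_def\<close>)
  then show ?thesis unfolding e using r by simp
qed

text \<open>The four sectors have openings \<theta> and pi - \<theta>, both below pi, so the bound K
  spreads to the whole plane and Liouville's theorem applies.\<close>

lemma entire_exp_type_bounded_on_rays_imp_constant:
  assumes f: "f holomorphic_on UNIV" and growth: "\<And>z. norm (f z) \<le> C * exp (B * norm z)" and "0 \<le> B"
    and \<theta>: "0 < \<theta>" "\<theta> < pi"
    and real: "\<And>x::real. norm (f (of_real x)) \<le> K"
    and ray: "\<And>r. 0 < r \<Longrightarrow> norm (f (rcis r \<theta>)) \<le> K" "\<And>r. 0 < r \<Longrightarrow> norm (f (rcis r (- \<theta>))) \<le> K"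
  shows "f z = f 0"
proof -
  \<comment> \<open>The sector estimate asks for positive constants, whereas \<open>K\<close> and
    \<open>C\<close> may be 0.\<close>
  define L where "L = max K 1"
  define D where "D = max C 1"
  have L: "0 < L" and D: "0 < D" by (simp_all add: L_def D_def)
  have gr: "norm (f z) \<le> D * exp (B * norm z)" for z
    using order_trans[OF growth[of z] mult_right_mono[of C D]] by (simp add: D_def)
  have pos: "norm (f (rcis r 0)) \<le> L" and neg: "norm (f (rcis r pi)) \<le> L" "norm (f (rcis r (- pi))) \<le> L" for r
  proof -
    have "rcis r 0 = of_real r" "rcis r pi = of_real (- r)" "rcis r (- pi) = of_real (- r)"
      by (simp_all add: complex_eq_iff)
    then show "norm (f (rcis r 0)) \<le> L" "norm (f (rcis r pi)) \<le> L" "norm (f (rcis r (- pi))) \<le> L"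
      using real[of r] real[of "- r"] by (simp_all add: L_def)
  qed
  have up: "norm (f (rcis r \<theta>)) \<le> L" and down: "norm (f (rcis r (- \<theta>))) \<le> L" if "0 < r" for r
    using ray[OF that] by (simp_all add: L_def)
  note PL = phragmen_lindelof_sector[OF f L D \<open>0 \<le> B\<close> gr]
  have "norm (f z) \<le> L" for z
  proof (cases "z = 0")
    case True
    then show ?thesis using real[of 0] by (simp add: L_def)
  next
    case False
    have z: "z = rcis (norm z) (Arg z)" and nz: "0 < norm z" using False by (simp_all add: rcis_cmod_Arg)
    have "- pi < Arg z" "Arg z \<le> pi" by (rule mpi_less_Arg, rule Arg_le_pi)
    then consider "Arg z \<le> - \<theta>" | "- \<theta> \<le> Arg z" "Arg z \<le> 0" | "0 \<le> Arg z" "Arg z \<le> \<theta>" | "\<theta> \<le> Arg z" by linarith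
    then have "norm (f (rcis (norm z) (Arg z))) \<le> L"
    proof cases
      case 1
      then show ?thesis using PL[of "- pi" "- \<theta>" "Arg z" "norm z"] \<theta> neg down nz mpi_less_Arg[of z] by auto
    next
      case 2
      then show ?thesis using PL[of "- \<theta>" 0 "Arg z" "norm z"] \<theta> pos down nz by auto
    next
      case 3
      then show ?thesis using PL[of 0 \<theta> "Arg z" "norm z"] \<theta> pos up nz by auto
    next
      case 4
      then show ?thesis using PL[of \<theta> pi "Arg z" "norm z"] \<theta> neg up nz Arg_le_pi[of z] by auto
    qed
    then show ?thesis using z by simp
  qed
  then have "bounded (range f)" unfolding bounded_iff by auto
  then have "f constant_on UNIV" using Liouville_theorem[OF f] by blast
  then show ?thesis unfolding constant_on_def by auto
qed

subsection \<open>Complex matrices and the Dirac system\<close>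

lemma bounded_bilinear_matrix_vector_mult:
  "bounded_bilinear ((*v) :: complex^'n^'m \<Rightarrow> complex^'n \<Rightarrow> complex^'m)"
proof -
  have "bilinear ((*v) :: complex^'n^'m \<Rightarrow> complex^'n \<Rightarrow> complex^'m)"
    unfolding bilinear_def
  proof (intro conjI allI)
    show "linear (\<lambda>A :: complex^'n^'m. A *v x)" for x
      by (rule linearI) (simp_all add: vec_eq_iff matrix_vector_mult_def sum.distrib algebra_simps scaleR_sum_right)
  qed simp
  then show ?thesis by (simp add: bilinear_conv_bounded_bilinear)
qed

lemma bounded_bilinear_matrix_matrix_mult:
  "bounded_bilinear ((**) :: complex^'n^'m \<Rightarrow> complex^'p^'n \<Rightarrow> complex^'p^'m)"
proof -
  have "bilinear ((**) :: complex^'n^'m \<Rightarrow> complex^'p^'n \<Rightarrow> complex^'p^'m)"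
    unfolding bilinear_def
    by (intro conjI allI linearI)
      (simp_all add: vec_eq_iff matrix_matrix_mult_def sum.distrib algebra_simps scaleR_sum_right)
  then show ?thesis by (simp add: bilinear_conv_bounded_bilinear)
qed

interpretation matvec: bounded_bilinear "(*v) :: complex^'n^'m \<Rightarrow> complex^'n \<Rightarrow> complex^'m"
  by (rule bounded_bilinear_matrix_vector_mult)

interpretation matmat: bounded_bilinear "(**) :: complex^'n^'m \<Rightarrow> complex^'p^'n \<Rightarrow> complex^'p^'m"
  by (rule bounded_bilinear_matrix_matrix_mult)

lemma bounded_linear_ctranspose: "bounded_linear (ctranspose :: complex^'n^'m \<Rightarrow> complex^'m^'n)"
  by (intro linear_conv_bounded_linear[THEN iffD1] linearI)
    (simp_all add: vec_eq_iff ctranspose_def transpose_def map_matrix_def)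

lemma ctranspose_nth [simp]: "ctranspose A $ i $ k = cnj (A $ k $ i)"
  by (simp add: ctranspose_def transpose_def map_matrix_def)

lemma ctranspose_ctranspose [simp]: "ctranspose (ctranspose A) = A"
  by (simp add: vec_eq_iff)

lemma ctranspose_matrix_mult: "ctranspose (A ** B) = ctranspose B ** ctranspose A"
  by (simp add: vec_eq_iff matrix_matrix_mult_def mult.commute)

lemma ctranspose_mat_1 [simp]: "ctranspose (mat 1) = mat 1"
  by (simp add: vec_eq_iff mat_def)

text \<open>The real inner product is the real part of the Hermitian one. It suffices throughout,
  since the energies to be estimated are real.\<close>

lemma inner_complex_vec: "(x :: complex^'n) \<bullet> y = Re (\<Sum>i\<in>UNIV. cnj (x $ i) * y $ i)"
  by (simp add: inner_vec_def inner_complex_def)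

lemma hform_eq_inner: "hform A x = x \<bullet> (A *v x)"
  by (simp add: hform_def inner_complex_vec)

lemma inner_matrix_vector_mult: "x \<bullet> (A *v y) = (ctranspose A *v x) \<bullet> y" for A :: "complex^'n^'m"
proof -
  have "(\<Sum>i\<in>UNIV. cnj (x $ i) * (A *v y) $ i) = (\<Sum>i\<in>UNIV. \<Sum>k\<in>UNIV. cnj (x $ i) * A $ i $ k * y $ k)"
    by (simp add: matrix_vector_mult_def sum_distrib_left mult.assoc)
  also have "\<dots> = (\<Sum>k\<in>UNIV. \<Sum>i\<in>UNIV. cnj (x $ i) * A $ i $ k * y $ k)" by (rule sum.swap)
  also have "\<dots> = (\<Sum>k\<in>UNIV. cnj ((ctranspose A *v x) $ k) * y $ k)"
    by (simp add: matrix_vector_mult_def sum_distrib_left sum_distrib_right mult_ac)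
  finally show ?thesis by (simp only: inner_complex_vec)
qed

text \<open>Transfers estimates to adjoints without computing an operator norm; it serves the
  inverse of \<open>u\<close> and the conjugate ray.\<close>

lemma norm_adjoint_bound:
  fixes A :: "complex^'n^'m"
  assumes "0 \<le> C" "\<And>x. norm (A *v x) \<le> C * norm x"
  shows "norm (ctranspose A *v y) \<le> C * norm y"
proof (cases "ctranspose A *v y = 0")
  case False
  have "norm (ctranspose A *v y) * norm (ctranspose A *v y) = (ctranspose A *v y) \<bullet> (ctranspose A *v y)"
    by (simp add: dot_square_norm power2_eq_square)
  also have "\<dots> = y \<bullet> (A *v (ctranspose A *v y))" by (simp only: inner_matrix_vector_mult)
  also have "\<dots> \<le> norm y * norm (A *v (ctranspose A *v y))" by (rule norm_cauchy_schwarz)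
  also have "\<dots> \<le> norm y * (C * norm (ctranspose A *v y))" by (intro mult_left_mono assms) auto
  finally show ?thesis using False by (simp add: mult.commute)
qed (use assms in auto)

lemma norm_mult_le_opnorm: "norm (A *v x) \<le> opnorm A * norm x" for A :: "complex^'n^'m"
  unfolding opnorm_def by (rule onorm[OF matvec.bounded_linear_right])

lemma opnorm_nonneg: "0 \<le> opnorm A" for A :: "complex^'n^'m"
  unfolding opnorm_def by (rule onorm_pos_le[OF matvec.bounded_linear_right])

lemma mat_mult_vec: "mat c *v x = c *s x" for x :: "complex^'n"
  by (simp add: vec_eq_iff matrix_vector_mult_def mat_def if_distrib[of "\<lambda>x. x * _"] cong: if_cong)

lemma norm_smult_vec: "norm (c *s x) = norm c * norm x" for x :: "complex^'n"
  by (simp add: norm_vec_def norm_mult L2_set_right_distrib)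

lemma bounded_linear_smult_vec: "bounded_linear (\<lambda>x :: complex^'n. c *s x)"
  using matvec.bounded_linear_right[of "mat c"] by (simp add: mat_mult_vec)

section \<open>Splitting of vectors into the blocks of sizes m1 and m2\<close>

definition upper :: "complex^('m1::finite+'m2::finite) \<Rightarrow> complex^'m1" where
  "upper y = (\<chi> i. y $ Inl i)"

definition lower :: "complex^('m1::finite+'m2::finite) \<Rightarrow> complex^'m2" where
  "lower y = (\<chi> i. y $ Inr i)"

definition join :: "complex^'m1::finite \<Rightarrow> complex^'m2::finite \<Rightarrow> complex^('m1+'m2)" where
  "join a b = (\<chi> i. case i of Inl k \<Rightarrow> a $ k | Inr k \<Rightarrow> b $ k)"

lemma upper_join [simp]: "upper (join a b) = a" and lower_join [simp]: "lower (join a b) = b"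
  by (simp_all add: upper_def lower_def join_def vec_eq_iff)

lemma upper_lower_eqI: "upper x = upper y \<Longrightarrow> lower x = lower y \<Longrightarrow> x = y"
  unfolding upper_def lower_def vec_eq_iff by (metis obj_sumE vec_lambda_beta)

lemma bounded_linear_upper: "bounded_linear upper"
  by (intro linear_conv_bounded_linear[THEN iffD1] linearI) (simp_all add: upper_def vec_eq_iff)

lemma bounded_linear_lower: "bounded_linear lower"
  by (intro linear_conv_bounded_linear[THEN iffD1] linearI) (simp_all add: lower_def vec_eq_iff)

lemma upper_add [simp]: "upper (x + y) = upper x + upper y"
  and upper_diff [simp]: "upper (x - y) = upper x - upper y"
  and upper_smult [simp]: "upper (c *s x) = c *s upper x"
  and upper_zero [simp]: "upper 0 = 0"
  by (simp_all add: upper_def vec_eq_iff)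

lemma lower_add [simp]: "lower (x + y) = lower x + lower y"
  and lower_diff [simp]: "lower (x - y) = lower x - lower y"
  and lower_smult [simp]: "lower (c *s x) = c *s lower x"
  and lower_zero [simp]: "lower 0 = 0"
  by (simp_all add: lower_def vec_eq_iff)

lemma upper_uminus [simp]: "upper (- x) = - upper x" and lower_uminus [simp]: "lower (- x) = - lower x"
  by (simp_all add: upper_def lower_def vec_eq_iff)

lemma sum_UNIV_sum_type:
  "(\<Sum>i\<in>(UNIV :: ('a::finite + 'b::finite) set). f i) = (\<Sum>a\<in>UNIV. f (Inl a)) + (\<Sum>b\<in>UNIV. f (Inr b))"
  by (simp add: sum.Plus flip: UNIV_Plus_UNIV)

lemma inner_upper_lower: "x \<bullet> y = upper x \<bullet> upper y + lower x \<bullet> lower y"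
  by (simp add: inner_vec_def sum_UNIV_sum_type upper_def lower_def)

lemma norm_upper_lower: "(norm x)\<^sup>2 = (norm (upper x))\<^sup>2 + (norm (lower x))\<^sup>2"
  by (simp add: power2_norm_eq_inner inner_upper_lower)

lemma norm_upper_le: "norm (upper x) \<le> norm x" and norm_lower_le: "norm (lower x) \<le> norm x"
  by (rule power2_le_imp_le; simp add: norm_upper_lower)+

lemma norm_le_upper_lower: "norm x \<le> norm (upper x) + norm (lower x)"
  by (rule power2_le_imp_le) (auto simp: norm_upper_lower power2_sum)

lemma upper_block_mat: "upper (block_mat A B C D *v x) = A *v upper x + B *v lower x"
  and lower_block_mat: "lower (block_mat A B C D *v x) = C *v upper x + D *v lower x"
  by (simp_all add: vec_eq_iff matrix_vector_mult_def upper_def lower_def block_mat_def sum_UNIV_sum_type)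

lemma block_row_mult: "block_row A B *v x = A *v upper x + B *v lower x"
  by (simp add: vec_eq_iff matrix_vector_mult_def upper_def lower_def block_row_def sum_UNIV_sum_type)

lemma upper_sig_j [simp]: "upper (sig_j *v x) = upper x"
  and lower_sig_j [simp]: "lower (sig_j *v x) = - lower x"
  by (simp_all add: sig_j_def upper_block_mat lower_block_mat matvec.minus_left)

section \<open>The coefficient matrix of the system and its symmetries\<close>

definition dirac_mat :: "complex \<Rightarrow> complex^'m2::finite^'m1::finite \<Rightarrow> complex^('m1+'m2)^('m1+'m2)" where
  "dirac_mat z w = mat (\<i> * z) ** sig_j + sig_j ** pot_V w"

lemma upper_dirac_mat: "upper (dirac_mat z w *v y) = (\<i> * z) *s upper y + w *v lower y"
  and lower_dirac_mat: "lower (dirac_mat z w *v y) = - ((\<i> * z) *s lower y) - ctranspose w *v upper y"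
proof -
  have *: "dirac_mat z w *v y = (\<i> * z) *s (sig_j *v y) + sig_j *v (pot_V w *v y)"
    by (simp add: dirac_mat_def matvec.add_left mat_mult_vec flip: matrix_vector_mul_assoc)
  show "upper (dirac_mat z w *v y) = (\<i> * z) *s upper y + w *v lower y"
    unfolding * by (simp add: pot_V_def upper_block_mat)
  show "lower (dirac_mat z w *v y) = - ((\<i> * z) *s lower y) - ctranspose w *v upper y"
    unfolding * by (simp add: pot_V_def lower_block_mat vec_eq_iff)
qed

lemma matrix_eqI: "(\<And>x. A *v x = B *v x) \<Longrightarrow> A = B" for A :: "complex^'n^'m"
  using matrix_eq by blast

text \<open>Skew-self-adjointness of the system enters here: this reflection in z is what makes the
  adjoint of \<open>u\<close> at \<open>cnj z\<close> the inverse of \<open>u\<close> at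
  \<open>z\<close>.\<close>

lemma ctranspose_dirac_mat: "ctranspose (dirac_mat z w) = - dirac_mat (cnj z) w"
proof -
  have "ctranspose (dirac_mat z w) $ i $ k = (- dirac_mat (cnj z) w) $ i $ k" for i k
    by (cases i; cases k)
      (simp_all add: dirac_mat_def matrix_matrix_mult_def sum_UNIV_sum_type sig_j_def pot_V_def block_mat_def mat_def
        sum_negf if_distrib[of "\<lambda>x. x * _"] if_distrib[of "\<lambda>x. _ * x"] if_distrib[of cnj] cong: if_cong)
  then show ?thesis by (simp add: vec_eq_iff)
qed

lemma bounded_linear_pot_V: "bounded_linear pot_V"
proof (intro linear_conv_bounded_linear[THEN iffD1] linearI)
  show "pot_V (a + b) = pot_V a + pot_V b" for a b :: "complex^'m2^'m1"
    by (simp add: pot_V_def block_mat_def vec_eq_iff split: sum.split)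
  show "pot_V (r *\<^sub>R a) = r *\<^sub>R pot_V a" for r and a :: "complex^'m2^'m1"
    by (simp add: pot_V_def block_mat_def vec_eq_iff split: sum.split)
qed

lemma matrix_inv_eqI:
  fixes A B :: "complex^'n^'n"
  assumes "A ** B = mat 1" "B ** A = mat 1"
  shows "matrix_inv A = B"
proof -
  have "A ** matrix_inv A = mat 1"
    unfolding matrix_inv_def by (rule someI2[of _ B]) (use assms in auto)
  then have "B ** (A ** matrix_inv A) = B" by simp
  then show ?thesis by (simp add: matrix_mul_assoc assms(2))
qed

lemma matrix_inv_right_of_injective:
  fixes A :: "complex^'n^'n"
  assumes "\<And>x. A *v x = 0 \<Longrightarrow> x = 0"
  shows "A ** matrix_inv A = mat 1"
proof -
  have "inj ((*v) A)"
  proof (rule injI)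
    fix x y assume "A *v x = A *v y"
    then show "x = y" using assms[of "x - y"] by (simp add: matvec.diff_right)
  qed
  then obtain B where "B ** A = mat 1" using matrix_left_invertible_injective by blast
  then show ?thesis using matrix_inv_eqI[of A B] matrix_left_right_inverse by auto
qed

lemma tendsto_join:
  assumes "(f \<longlongrightarrow> a) F" "(g \<longlongrightarrow> b) F"
  shows "((\<lambda>x. join (f x) (g x)) \<longlongrightarrow> join a b) F"
  unfolding join_def
  using tendsto_vec_nth[OF assms(1)] tendsto_vec_nth[OF assms(2)]
  by (intro tendsto_vec_lambda) (auto split: sum.split)

lemma opnorm_diff_commute: "opnorm (A - B) = opnorm (B - A)" for A B :: "complex^'n^'m"
proof -
  have "(\<lambda>x. (A - B) *v x) = (\<lambda>x. - ((B - A) *v x))"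
    by (simp add: fun_eq_iff matvec.diff_left)
  then show ?thesis unfolding opnorm_def by (simp only: onorm_neg)
qed

lemma sig_j_squared: "sig_j ** sig_j = (mat 1 :: complex^('m1::finite+'m2::finite)^('m1+'m2))"
  by (rule matrix_eqI, rule upper_lower_eqI) (simp_all flip: matrix_vector_mul_assoc)

text \<open>At z = 0 the coefficient is block off-diagonal. Conjugation by j, which fixes block
  diagonal matrices, reverses its sign.\<close>

lemma dirac_mat_anticommute: "sig_j ** dirac_mat 0 w = - (dirac_mat 0 w ** sig_j)"
proof (rule matrix_eqI)
  fix x
  have "sig_j *v (dirac_mat 0 w *v x) = - (dirac_mat 0 w *v (sig_j *v x))"
    by (rule upper_lower_eqI)
      (simp_all add: upper_dirac_mat lower_dirac_mat matvec.minus_right)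
  then show "(sig_j ** dirac_mat 0 w) *v x = - (dirac_mat 0 w ** sig_j) *v x"
    by (simp add: matvec.minus_left flip: matrix_vector_mul_assoc)
qed

lemma dirac_mat_1_0: "dirac_mat 1 w = dirac_mat 0 w + mat \<i> ** sig_j"
  by (simp add: dirac_mat_def mat_def[of 0] matmat.zero_left vec_eq_iff[of "\<chi> i j. if i = j then 0 else 0"] zero_vec_def[symmetric])

lemma mat_commute: "mat c ** A = A ** mat c" for A :: "complex^'n^'n"
  by (rule matrix_eqI) (simp add: mat_mult_vec vector_scalar_commute flip: matrix_vector_mul_assoc)

lemma dirac_mat_inject:
  assumes "dirac_mat z w = dirac_mat z w'"
  shows "w = w'"
proof (rule matrix_eqI)
  fix b
  have "upper (dirac_mat z w *v join 0 b) = upper (dirac_mat z w' *v join 0 b)" by (simp add: assms)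
  then show "w *v b = w' *v b" by (simp add: upper_dirac_mat)
qed

subsection \<open>Solutions of the Dirac system\<close>

text \<open>The source of the exponential rates: for Im z > 0 the term iz damps the upper block and,
  with the opposite sign, amplifies the lower one.\<close>

lemma inner_i_smult: "a \<bullet> ((\<i> * z) *s a) = - Im z * (norm a)\<^sup>2" for a :: "complex^'n"
proof -
  have "a \<bullet> ((\<i> * z) *s a) = (\<Sum>i\<in>UNIV. - Im z * (norm (a $ i))\<^sup>2)"
    unfolding inner_vec_def
    by (intro sum.cong refl, simp add: inner_complex_def cmod_power2) (simp add: power2_eq_square algebra_simps)
  also have "\<dots> = - Im z * (norm a)\<^sup>2"
    by (simp add: norm_vec_def L2_set_def sum_nonneg sum_distrib_left sum_negf)
  finally show ?thesis .
qed

lemma borel_measurable_continuous_compose: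
  fixes f :: "real \<Rightarrow> 'a::euclidean_space" and g :: "'a \<Rightarrow> 'b::euclidean_space"
  assumes "continuous_on UNIV g" "f \<in> borel_measurable M"
  shows "(\<lambda>x. g (f x)) \<in> borel_measurable M"
  using measurable_compose[OF assms(2) borel_measurable_continuous_onI[OF assms(1)]] .

text \<open>The exponent has the shape in which \<open>primitive_exp_bound\<close> with s = 0
  delivers estimates of squared norms.\<close>

lemma sq_exp_bound:
  fixes a b k x :: real
  assumes "a\<^sup>2 \<le> exp ((2 * k) * (x - 0)) * b\<^sup>2" "0 \<le> b"
  shows "a \<le> exp (k * x) * b"
proof -
  have "exp ((2 * k) * (x - 0)) = (exp (k * x))\<^sup>2"
    unfolding exp_double[symmetric] by (simp only: diff_zero mult.assoc)
  then have "a\<^sup>2 \<le> (exp (k * x) * b)\<^sup>2" using assms(1) unfolding power_mult_distrib by (simp only:)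
  then show ?thesis by (rule power2_le_imp_le) (simp add: assms(2))
qed

lemma sq_exp_lower_bound:
  fixes a b k x :: real
  assumes "exp ((2 * k) * (x - 0)) * b\<^sup>2 \<le> a\<^sup>2" "0 \<le> a"
  shows "exp (k * x) * b \<le> a"
proof -
  have "exp ((2 * k) * (x - 0)) = (exp (k * x))\<^sup>2"
    unfolding exp_double[symmetric] by (simp only: diff_zero mult.assoc)
  then have "(exp (k * x) * b)\<^sup>2 \<le> a\<^sup>2" using assms(1) unfolding power_mult_distrib by (simp only:)
  then show ?thesis by (rule power2_le_imp_le) (simp add: assms(2))
qed

locale dirac_potential =
  fixes l M :: real and v :: "real \<Rightarrow> complex^'m2::finite^'m1::finite"
  assumes l: "0 < l" and meas: "v \<in> borel_measurable (lebesgue_on {0..l})" and bdd: "bounded (v ` {0..l})"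
    and bound: "\<And>x. x \<in> {0..l} \<Longrightarrow> opnorm (v x) \<le> M"
begin

lemma M_nonneg: "0 \<le> M"
  using order_trans[OF opnorm_nonneg bound[of 0]] l by simp

definition is_sol :: "complex \<Rightarrow> (real \<Rightarrow> complex^('m1+'m2)) \<Rightarrow> bool" where
  "is_sol z y \<longleftrightarrow> primitive l y (\<lambda>x. dirac_mat z (v x) *v y x)"

text \<open>The choice is immaterial on {0..l}: \<open>sol_eq_u\<close> determines the values there,
  and \<open>fundamental_solution_eq_u\<close> identifies them with those of any fundamental
  solution.\<close>

definition u :: "complex \<Rightarrow> real \<Rightarrow> complex^('m1+'m2)^('m1+'m2)" where
  "u z = (SOME Y. Y 0 = mat 1 \<and> primitive l Y (\<lambda>x. dirac_mat z (v x) ** Y x))"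

lemma dirac_mat_bounded: "bounded ((\<lambda>x. dirac_mat z (v x)) ` {0..l})"
proof -
  have "bounded ((\<lambda>x. mat (\<i> * z) ** sig_j + x) ` (\<lambda>w. sig_j ** pot_V w) ` v ` {0..l})"
    by (intro bounded_translation bounded_linear_image[OF bdd]
        bounded_linear_compose[OF matmat.bounded_linear_right bounded_linear_pot_V])
  then show ?thesis by (simp add: image_image dirac_mat_def)
qed

lemma u: "u z 0 = mat 1" "primitive l (u z) (\<lambda>x. dirac_mat z (v x) ** u z x)"
proof -
  have lin: "bounded_linear (\<lambda>w. sig_j ** pot_V w)"
    by (rule bounded_linear_compose[OF matmat.bounded_linear_right bounded_linear_pot_V])
  have "(\<lambda>x. dirac_mat z (v x)) \<in> borel_measurable (lebesgue_on {0..l})"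
    unfolding dirac_mat_def
    by (rule borel_measurable_continuous_compose[OF _ meas])
      (intro continuous_intros linear_continuous_on lin)
  then have "\<exists>Y. Y 0 = mat 1 \<and> primitive l Y (\<lambda>x. dirac_mat z (v x) ** Y x)"
    using l dirac_mat_bounded by (intro volterra_exists[OF bounded_bilinear_matrix_matrix_mult]) auto
  from someI_ex[OF this] show "u z 0 = mat 1" "primitive l (u z) (\<lambda>x. dirac_mat z (v x) ** u z x)"
    by (simp_all add: u_def)
qed

lemma is_sol_u: "is_sol z (\<lambda>x. u z x *v h)"
  using primitive_bounded_linear[OF matvec.bounded_linear_left u(2)]
  by (simp add: is_sol_def matrix_vector_mul_assoc)

lemma is_sol_diff: "is_sol z y \<Longrightarrow> is_sol z y' \<Longrightarrow> is_sol z (\<lambda>x. y x - y' x)"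
  using primitive_diff[of l y _ y'] by (simp add: is_sol_def matvec.diff_right)

section \<open>Energy identities and uniqueness\<close>

lemma coupling_bound:
  assumes "x \<in> {0..l}"
  shows "\<bar>a \<bullet> (v x *v b)\<bar> \<le> M * norm a * norm b"
proof -
  have "\<bar>a \<bullet> (v x *v b)\<bar> \<le> norm a * norm (v x *v b)" by (rule Cauchy_Schwarz_ineq2)
  also have "\<dots> \<le> norm a * (M * norm b)"
    by (intro mult_left_mono order_trans[OF norm_mult_le_opnorm mult_right_mono] bound assms) auto
  finally show ?thesis by (simp add: mult_ac)
qed

text \<open>The coupling term appears here and in \<open>primitive_norm_lower\<close> with opposite
  signs: it cancels in the sum of the two energies and doubles in their difference.\<close>

lemma primitive_norm_upper:
  assumes "is_sol z y"
  shows "primitive l (\<lambda>x. (norm (upper (y x)))\<^sup>2)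
    (\<lambda>x. 2 * (- Im z * (norm (upper (y x)))\<^sup>2 + upper (y x) \<bullet> (v x *v lower (y x))))"
  by (rule primitive_cong[OF primitive_inner_self[OF primitive_bounded_linear[OF bounded_linear_upper assms[unfolded is_sol_def]]]])
    (simp_all add: power2_norm_eq_inner upper_dirac_mat inner_add_right inner_i_smult)

lemma primitive_norm_lower:
  assumes "is_sol z y"
  shows "primitive l (\<lambda>x. (norm (lower (y x)))\<^sup>2)
    (\<lambda>x. 2 * (Im z * (norm (lower (y x)))\<^sup>2 - upper (y x) \<bullet> (v x *v lower (y x))))"
  by (rule primitive_cong[OF primitive_inner_self[OF primitive_bounded_linear[OF bounded_linear_lower assms[unfolded is_sol_def]]]])
    (simp_all add: power2_norm_eq_inner lower_dirac_mat inner_diff_right inner_i_smult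
      inner_matrix_vector_mult[of "upper _"] inner_commute)

text \<open>The potential drops out of the derivative of the full energy, so the rate is |Im z|
  whatever M is. Applied to differences of solutions this gives uniqueness; for real z it gives the
  bound 1.\<close>

lemma norm_sol:
  assumes y: "is_sol z y" and x: "x \<in> {0..l}"
  shows "norm (y x) \<le> exp (\<bar>Im z\<bar> * x) * norm (y 0)"
proof -
  have "primitive l (\<lambda>x. (norm (y x))\<^sup>2) (\<lambda>x. 2 * Im z * ((norm (lower (y x)))\<^sup>2 - (norm (upper (y x)))\<^sup>2))"
    by (rule primitive_cong[OF primitive_add[OF primitive_norm_upper[OF y] primitive_norm_lower[OF y]]])
      (simp_all add: norm_upper_lower algebra_simps)
  then have "(norm (y x))\<^sup>2 \<le> exp ((2 * \<bar>Im z\<bar>) * (x - 0)) * (norm (y 0))\<^sup>2"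
  proof (rule primitive_exp_bound)
    fix x
    have "Im z * ((norm (lower (y x)))\<^sup>2 - (norm (upper (y x)))\<^sup>2) \<le> \<bar>Im z\<bar> * \<bar>(norm (lower (y x)))\<^sup>2 - (norm (upper (y x)))\<^sup>2\<bar>"
      by (metis abs_ge_self abs_mult)
    also have "\<dots> \<le> \<bar>Im z\<bar> * (norm (y x))\<^sup>2"
      by (intro mult_left_mono) (simp_all add: norm_upper_lower abs_le_iff add_increasing)
    finally show "2 * Im z * ((norm (lower (y x)))\<^sup>2 - (norm (upper (y x)))\<^sup>2) \<le> 2 * \<bar>Im z\<bar> * (norm (y x))\<^sup>2"
      by simp
  qed (use x in auto)
  then show ?thesis by (rule sq_exp_bound) simp
qed

lemma norm_u_mult: "x \<in> {0..l} \<Longrightarrow> norm (u z x *v h) \<le> exp (\<bar>Im z\<bar> * x) * norm h"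
  using norm_sol[OF is_sol_u] by (simp add: u(1))

lemma sol_eq_u:
  assumes y: "is_sol z y" and x: "x \<in> {0..l}"
  shows "y x = u z x *v y 0"
  using norm_sol[OF is_sol_diff[OF y is_sol_u[of z "y 0"]] x] by (simp add: u(1))

text \<open>With two spectral parameters the potential cancels and only i(z' - z)j remains. The case
  z' = z is the inverse formula, and z' tending to z yields continuity and differentiability of
  \<open>u\<close> in z.\<close>

lemma u_ctranspose_prod:
  assumes x: "x \<in> {0..l}"
  shows "((\<lambda>t. (\<i> * (z' - z)) *s (ctranspose (u (cnj z) t) *v (sig_j *v (u z' t *v h)))) has_integral
    ctranspose (u (cnj z) x) *v (u z' x *v h) - h) {0..x}"
proof -
  let ?c = "\<lambda>x. ctranspose (u (cnj z) x)"
  have "primitive l ?c (\<lambda>x. ctranspose (dirac_mat (cnj z) (v x) ** u (cnj z) x))"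
    by (rule primitive_bounded_linear[OF bounded_linear_ctranspose u(2)])
  from primitive_bilinear[OF bounded_bilinear_matrix_vector_mult this is_sol_u[unfolded is_sol_def]]
  have "primitive l (\<lambda>x. ?c x *v (u z' x *v h))
    (\<lambda>x. (\<i> * (z' - z)) *s (?c x *v (sig_j *v (u z' x *v h))))"
  proof (rule primitive_cong)
    fix x
    have "ctranspose (dirac_mat (cnj z) (v x) ** u (cnj z) x) *v (u z' x *v h) + ?c x *v (dirac_mat z' (v x) *v (u z' x *v h))
      = ?c x *v (dirac_mat z' (v x) *v (u z' x *v h) - dirac_mat z (v x) *v (u z' x *v h))"
      by (simp add: ctranspose_matrix_mult ctranspose_dirac_mat matvec.diff_right matvec.minus_left matvec.minus_right flip: matrix_vector_mul_assoc)
    also have "dirac_mat z' (v x) *v (u z' x *v h) - dirac_mat z (v x) *v (u z' x *v h) = (\<i> * (z' - z)) *s (sig_j *v (u z' x *v h))"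
      by (rule upper_lower_eqI) (simp_all add: upper_dirac_mat lower_dirac_mat vec_eq_iff algebra_simps)
    finally show "ctranspose (dirac_mat (cnj z) (v x) ** u (cnj z) x) *v (u z' x *v h) + ?c x *v (dirac_mat z' (v x) *v (u z' x *v h))
      = (\<i> * (z' - z)) *s (?c x *v (sig_j *v (u z' x *v h)))"
      by (simp add: vector_scalar_commute)
  qed simp
  then show ?thesis using x by (simp add: primitive_def u(1))
qed

lemma u_unitary: "x \<in> {0..l} \<Longrightarrow> ctranspose (u (cnj z) x) ** u z x = mat 1"
proof (rule matrix_eqI)
  fix h assume "x \<in> {0..l}"
  then show "(ctranspose (u (cnj z) x) ** u z x) *v h = mat 1 *v h"
    using u_ctranspose_prod[of x z z h] by (simp flip: matrix_vector_mul_assoc)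
qed

lemma u_unitary': "x \<in> {0..l} \<Longrightarrow> u z x ** ctranspose (u (cnj z) x) = mat 1"
  using u_unitary matrix_left_right_inverse by blast

lemma norm_ctranspose_u_mult: "x \<in> {0..l} \<Longrightarrow> norm (ctranspose (u z x) *v h) \<le> exp (\<bar>Im z\<bar> * x) * norm h"
  by (rule norm_adjoint_bound) (auto intro: norm_u_mult)

text \<open>A local Lipschitz estimate in z, uniform in x; it makes the integral \<open>T\<close> in
  \<open>u_field_differentiable\<close> continuous.\<close>

lemma u_diff_bound:
  assumes x: "x \<in> {0..l}"
  shows "norm (u z' x *v h - u z x *v h) \<le>
    norm (z' - z) * (l * exp (2 * \<bar>Im z\<bar> * l + \<bar>Im z'\<bar> * l) * norm h)"
proof -
  let ?c = "\<lambda>x. ctranspose (u (cnj z) x)"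
  have mono: "exp (\<bar>Im w\<bar> * t) \<le> exp (\<bar>Im w\<bar> * l)" if "t \<le> l" for w t
    using that by (simp add: mult_left_mono)
  have "norm (?c x *v (u z' x *v h) - h) \<le> norm (z' - z) * (exp (\<bar>Im z\<bar> * l) * (exp (\<bar>Im z'\<bar> * l) * norm h)) * measure lborel (cbox 0 x)"
  proof (rule has_integral_bound[OF _ u_ctranspose_prod[OF x, unfolded box_real(2)[symmetric]]])
    fix t assume "t \<in> cbox 0 x"
    then have t: "t \<in> {0..l}" using x by auto
    have sj: "norm (sig_j *v y) = norm y" for y :: "complex^('m1+'m2)"
      by (rule power2_eq_imp_eq) (simp_all add: norm_upper_lower)
    have "norm (?c t *v (sig_j *v (u z' t *v h))) \<le> exp (\<bar>Im z\<bar> * t) * norm (sig_j *v (u z' t *v h))"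
      using norm_ctranspose_u_mult[OF t, of "cnj z"] by simp
    also have "\<dots> \<le> exp (\<bar>Im z\<bar> * t) * (exp (\<bar>Im z'\<bar> * t) * norm h)"
      unfolding sj by (intro mult_left_mono norm_u_mult t) auto
    also have "\<dots> \<le> exp (\<bar>Im z\<bar> * l) * (exp (\<bar>Im z'\<bar> * l) * norm h)"
      using t by (intro mult_mono mono) auto
    finally show "norm ((\<i> * (z' - z)) *s (?c t *v (sig_j *v (u z' t *v h)))) \<le>
        norm (z' - z) * (exp (\<bar>Im z\<bar> * l) * (exp (\<bar>Im z'\<bar> * l) * norm h))"
      by (simp add: norm_smult_vec norm_mult mult_left_mono)
  qed auto
  also have "\<dots> \<le> norm (z' - z) * (exp (\<bar>Im z\<bar> * l) * (exp (\<bar>Im z'\<bar> * l) * norm h)) * l"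
    using x by (intro mult_left_mono) auto
  finally have 1: "norm (?c x *v (u z' x *v h) - h) \<le> norm (z' - z) * (exp (\<bar>Im z\<bar> * l) * (exp (\<bar>Im z'\<bar> * l) * norm h)) * l" .
  have "u z' x *v h - u z x *v h = u z x *v (?c x *v (u z' x *v h) - h)"
    using u_unitary'[OF x, of z] by (simp add: matvec.diff_right matrix_vector_mul_assoc matrix_mul_assoc)
  then have "norm (u z' x *v h - u z x *v h) \<le> exp (\<bar>Im z\<bar> * x) * norm (?c x *v (u z' x *v h) - h)"
    using norm_u_mult[OF x] by simp
  also have "\<dots> \<le> exp (\<bar>Im z\<bar> * l) * (norm (z' - z) * (exp (\<bar>Im z\<bar> * l) * (exp (\<bar>Im z'\<bar> * l) * norm h)) * l)"
    using x by (intro mult_mono 1 mono) auto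
  also have "\<dots> = norm (z' - z) * (l * exp (2 * \<bar>Im z\<bar> * l + \<bar>Im z'\<bar> * l) * norm h)"
    by (simp add: exp_add mult_ac) (simp add: mult.assoc[symmetric] flip: exp_add)
  finally show ?thesis .
qed

lemma u_field_differentiable:
  assumes x: "x \<in> {0..l}"
  shows "(\<lambda>z. (u z x *v h) $ i) field_differentiable at z"
proof -
  define g where "g z' t = ctranspose (u (cnj z) t) *v (sig_j *v (u z' t *v h))" for z' t
  define T where "T z' = integral {0..x} (g z')" for z'
  have cont_u: "continuous_on {0..l} (u z')" for z' by (rule primitive_continuous[OF u(2)])
  have "continuous_on {0..l} (g z')" for z'
    unfolding g_def
    by (intro matvec.continuous_on continuous_on_const cont_u
        bounded_linear.continuous_on[OF bounded_linear_ctranspose])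
  then have g: "g z' integrable_on {0..x}" for z'
    using x by (intro integrable_continuous_real) (rule continuous_on_subset, auto)
  \<comment> \<open>The difference quotient in z is thereby i u(z,x) T(z') exactly, so the
    derivative exists once T is continuous at z; nothing is differentiated under the
    integral.\<close>
  have eq: "u z' x *v h - u z x *v h = (\<i> * (z' - z)) *s (u z x *v T z')" for z'
  proof -
    have "((\<lambda>t. (\<i> * (z' - z)) *s g z' t) has_integral (\<i> * (z' - z)) *s T z') {0..x}"
      using has_integral_linear[OF integrable_integral[OF g] bounded_linear_smult_vec] by (simp add: o_def T_def)
    then have "ctranspose (u (cnj z) x) *v (u z' x *v h) - h = (\<i> * (z' - z)) *s T z'"
      using u_ctranspose_prod[OF x, of z' z h] unfolding g_def by (rule has_integral_unique[rotated])
    then have "u z x *v (ctranspose (u (cnj z) x) *v (u z' x *v h)) - u z x *v h = u z x *v ((\<i> * (z' - z)) *s T z')"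
      by (simp flip: matvec.diff_right)
    then show ?thesis
      using u_unitary'[OF x, of z] by (simp add: matrix_vector_mul_assoc matrix_mul_assoc vector_scalar_commute)
  qed
  have "((\<lambda>z'. T z' - T z) \<longlongrightarrow> 0) (at z)"
  proof (rule Lim_null_comparison)
    \<comment> \<open>For z' within distance 1 of z, |Im z'| is at most |Im z| + 1, so this constant
      does not depend on z'.\<close>
    let ?K = "exp (\<bar>Im z\<bar> * l) * (l * exp (2 * \<bar>Im z\<bar> * l + (\<bar>Im z\<bar> + 1) * l) * norm h) * l"
    show "\<forall>\<^sub>F z' in at z. norm (T z' - T z) \<le> norm (z' - z) * ?K"
      unfolding eventually_at
    proof (intro exI[of _ 1] conjI ballI impI)
      fix z' assume "z' \<noteq> z \<and> dist z' z < 1"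
      then have "\<bar>Im z' - Im z\<bar> < 1"
        using abs_Im_le_cmod[of "z' - z"] by (simp add: dist_norm)
      then have "\<bar>Im z'\<bar> \<le> \<bar>Im z\<bar> + 1" by arith
      have gT: "((\<lambda>t. g z' t - g z t) has_integral T z' - T z) (cbox 0 x)"
        unfolding T_def box_real(2) by (intro has_integral_diff integrable_integral g)
      have "norm (T z' - T z) \<le> norm (z' - z) * (exp (\<bar>Im z\<bar> * l) * (l * exp (2 * \<bar>Im z\<bar> * l + (\<bar>Im z\<bar> + 1) * l) * norm h)) * measure lborel (cbox 0 x)"
      proof (rule has_integral_bound[OF _ gT])
        fix t assume "t \<in> cbox 0 x"
        then have t: "t \<in> {0..l}" using x by auto
        have sj: "norm (sig_j *v y) = norm y" for y :: "complex^('m1+'m2)"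
          by (rule power2_eq_imp_eq) (simp_all add: norm_upper_lower)
        have "norm (g z' t - g z t) \<le> exp (\<bar>Im z\<bar> * t) * norm (sig_j *v (u z' t *v h - u z t *v h))"
          using norm_ctranspose_u_mult[OF t, of "cnj z"] by (simp add: g_def flip: matvec.diff_right)
        also have "\<dots> \<le> exp (\<bar>Im z\<bar> * l) * (norm (z' - z) * (l * exp (2 * \<bar>Im z\<bar> * l + \<bar>Im z'\<bar> * l) * norm h))"
          unfolding sj using t by (intro mult_mono u_diff_bound) (auto intro!: mult_left_mono)
        also have "\<dots> \<le> exp (\<bar>Im z\<bar> * l) * (norm (z' - z) * (l * exp (2 * \<bar>Im z\<bar> * l + (\<bar>Im z\<bar> + 1) * l) * norm h))"
          using l \<open>\<bar>Im z'\<bar> \<le> \<bar>Im z\<bar> + 1\<close> by (intro mult_left_mono mult_right_mono) (auto intro!: mult_right_mono)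
        finally show "norm (g z' t - g z t) \<le> norm (z' - z) * (exp (\<bar>Im z\<bar> * l) * (l * exp (2 * \<bar>Im z\<bar> * l + (\<bar>Im z\<bar> + 1) * l) * norm h))"
          by (simp add: mult_ac)
      qed (use l in auto)
      also have "\<dots> \<le> norm (z' - z) * (exp (\<bar>Im z\<bar> * l) * (l * exp (2 * \<bar>Im z\<bar> * l + (\<bar>Im z\<bar> + 1) * l) * norm h)) * l"
        using x l by (intro mult_left_mono) auto
      finally show "norm (T z' - T z) \<le> norm (z' - z) * ?K" by (simp add: mult_ac)
    qed simp
    have "((\<lambda>z'. norm (z' - z) * ?K) \<longlongrightarrow> norm (z - z) * ?K) (at z)"
      by (intro tendsto_intros)
    then show "((\<lambda>z'. norm (z' - z) * ?K) \<longlongrightarrow> 0) (at z)" by simp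
  qed
  then have "(T \<longlongrightarrow> T z) (at z)" by (rule LIM_zero_cancel)
  then have 1: "((\<lambda>z'. \<i> * (u z x *v T z') $ i) \<longlongrightarrow> \<i> * (u z x *v T z) $ i) (at z)"
    by (intro tendsto_intros bounded_linear.tendsto[OF matvec.bounded_linear_right])
  have 2: "\<i> * (u z x *v T z') $ i = ((u z' x *v h) $ i - (u z x *v h) $ i) / (z' - z)" if "z' \<noteq> z" for z'
    using arg_cong[OF eq[of z'], of "\<lambda>y. y $ i"] that by simp
  have "((\<lambda>z'. ((u z' x *v h) $ i - (u z x *v h) $ i) / (z' - z)) \<longlongrightarrow> \<i> * (u z x *v T z) $ i) (at z)"
    by (rule Lim_transform_eventually[OF 1]) (simp add: eventually_at_filter 2)
  then show ?thesis
    unfolding field_differentiable_def has_field_derivative_iff by blast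
qed

lemma u_holomorphic: "x \<in> {0..l} \<Longrightarrow> (\<lambda>z. u z x $ i $ k) holomorphic_on UNIV"
proof -
  assume x: "x \<in> {0..l}"
  have "(u z x *v axis k 1) $ i = u z x $ i $ k" for z
    by (simp add: matrix_vector_mult_def axis_def if_distrib[of "\<lambda>x. _ * x"] cong: if_cong)
  then show ?thesis
    using u_field_differentiable[OF x, of "axis k 1" i]
    by (auto simp: holomorphic_on_def intro: field_differentiable_at_within)
qed

text \<open>The two conjugations cancel. Hence the inverse of \<open>u\<close> is entire in z as
  well.\<close>

lemma ctranspose_u_holomorphic:
  assumes "x \<in> {0..l}"
  shows "(\<lambda>z. ctranspose (u (cnj z) x) $ i $ k) holomorphic_on UNIV"
proof -
  have "(cnj \<circ> (\<lambda>z. u z x $ k $ i) \<circ> cnj) holomorphic_on UNIV"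
    by (intro holomorphic_on_compose_cnj_cnj holomorphic_on_subset[OF u_holomorphic[OF assms]]) auto
  then show ?thesis by (simp add: o_def)
qed

lemma fundamental_solution_eq_u:
  assumes y: "fundamental_solution l v z y" and x: "x \<in> {0..l}"
  shows "y x = u z x"
proof -
  have ac: "abs_cont_on 0 l y" and y0: "y 0 = mat 1"
    and ae: "AE x in lebesgue_on {0<..<l}. (y has_vector_derivative dirac_mat z (v x) ** y x) (at x)"
    using y by (simp_all add: fundamental_solution_def dirac_mat_def)
  have S: "{0<..<l} \<inter> space lebesgue \<in> sets lebesgue" by simp
  have "AE x in lebesgue. x \<in> {0<..<l} \<longrightarrow> (y has_vector_derivative dirac_mat z (v x) ** y x) (at x)"
    using ae unfolding AE_restrict_space_iff[OF S] .
  then obtain N where N: "negligible N"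
      "{x. \<not> (x \<in> {0<..<l} \<longrightarrow> (y has_vector_derivative dirac_mat z (v x) ** y x) (at x))} \<subseteq> N"
    unfolding eventually_ae_filter_negligible by blast
  have "primitive l y (\<lambda>x. dirac_mat z (v x) ** y x)"
    unfolding primitive_def
  proof (intro conjI ballI)
    obtain B where B: "\<And>x. x \<in> {0..l} \<Longrightarrow> norm (y x) \<le> B"
      using compact_imp_bounded[OF compact_continuous_image[OF abs_cont_on_imp_continuous_on[OF ac] compact_Icc]]
      unfolding bounded_iff by (metis imageI)
    obtain C where C: "\<And>x. x \<in> {0..l} \<Longrightarrow> norm (dirac_mat z (v x)) \<le> C"
      using dirac_mat_bounded[of z] unfolding bounded_iff by (metis imageI)
    obtain K where K: "0 < K" "\<And>(A :: complex^('m1+'m2)^('m1+'m2)) (B :: complex^('m1+'m2)^('m1+'m2)). norm (A ** B) \<le> norm A * norm B * K"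
      using matmat.pos_bounded by blast
    have "norm (dirac_mat z (v x) ** y x) \<le> C * B * K" if "x \<in> {0..l}" for x
    proof -
      have "norm (dirac_mat z (v x) ** y x) \<le> norm (dirac_mat z (v x)) * norm (y x) * K" by (rule K(2))
      also have "\<dots> \<le> C * B * K"
        using B[OF that] C[OF that] K(1) order_trans[OF norm_ge_zero C[OF that]]
        by (intro mult_right_mono mult_mono) auto
      finally show ?thesis .
    qed
    then show "bounded ((\<lambda>x. dirac_mat z (v x) ** y x) ` {0..l})" unfolding bounded_iff by blast
    fix x assume x: "x \<in> {0..l}"
    show "((\<lambda>x. dirac_mat z (v x) ** y x) has_integral y x - y 0) {0..x}"
    proof (rule has_integral_abs_cont_on)
      show "abs_cont_on 0 x y" using abs_cont_on_subset[OF ac] x by auto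
      show "negligible (N \<union> {0, l})" using N(1) by (simp add: negligible_Un)
      fix t assume "t \<in> {0..x} - (N \<union> {0, l})"
      then have "t \<in> {0<..<l}" "t \<notin> N" using x by auto
      then show "(y has_vector_derivative dirac_mat z (v t) ** y t) (at t within {0..x})"
        using N(2) has_vector_derivative_at_within by blast
    qed (use x in auto)
  qed
  then have "is_sol z (\<lambda>x. y x *v h)" for h
    using primitive_bounded_linear[OF matvec.bounded_linear_left, of l y _ h]
    by (simp add: is_sol_def matrix_vector_mul_assoc)
  from sol_eq_u[OF this x] show ?thesis by (intro matrix_eqI) (simp add: y0)
qed

text \<open>With a = |upper| and b = |lower|, the derivative of a^2 - b^2 is at most -2 Im z (a -
  b)^2, because the coupling is at most M a b \<le> Im z a b. A sign at l is therefore passed on to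
  all smaller x.\<close>

lemma lower_le_upper_backward:
  assumes y: "is_sol z y" and z: "M \<le> Im z" and yl: "norm (lower (y l)) \<le> norm (upper (y l))" and x: "x \<in> {0..l}"
  shows "norm (lower (y x)) \<le> norm (upper (y x))"
proof -
  have "(norm (upper (y l)))\<^sup>2 - (norm (lower (y l)))\<^sup>2 \<le> (norm (upper (y x)))\<^sup>2 - (norm (lower (y x)))\<^sup>2"
  proof (rule primitive_antimono[OF primitive_diff[OF primitive_norm_upper[OF y] primitive_norm_lower[OF y]]])
    fix t assume t: "t \<in> {0..l}"
    let ?a = "norm (upper (y t))" and ?b = "norm (lower (y t))" and ?c = "upper (y t) \<bullet> (v t *v lower (y t))"
    have "?c \<le> M * (?a * ?b)" using coupling_bound[OF t, of "upper (y t)" "lower (y t)"] by (simp add: mult.assoc)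
    also have "\<dots> \<le> Im z * (?a * ?b)" using z by (intro mult_right_mono) auto
    finally have "4 * ?c - 2 * Im z * (?a\<^sup>2 + ?b\<^sup>2) \<le> - 2 * Im z * (?a - ?b)\<^sup>2"
      by (simp add: power2_eq_square algebra_simps)
    also have "\<dots> \<le> 0" using z M_nonneg by simp
    finally show "2 * (- Im z * ?a\<^sup>2 + ?c) - 2 * (Im z * ?b\<^sup>2 - ?c) \<le> 0" by (simp add: algebra_simps)
  qed (use x in auto)
  moreover have "(norm (lower (y l)))\<^sup>2 \<le> (norm (upper (y l)))\<^sup>2" using yl by (intro power_mono) auto
  ultimately have "(norm (lower (y x)))\<^sup>2 \<le> (norm (upper (y x)))\<^sup>2" by linarith
  then show ?thesis by (rule power2_le_imp_le) simp
qed

text \<open>Inside the cone the coupling is at most M |upper|^2, which perturbs the free rate -Im z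
  by at most M in either direction.\<close>

lemma upper_exp_bounds:
  assumes y: "is_sol z y" and cone: "\<And>t. t \<in> {0..l} \<Longrightarrow> norm (lower (y t)) \<le> norm (upper (y t))" and x: "x \<in> {0..l}"
  shows "norm (upper (y x)) \<le> exp (- (Im z - M) * x) * norm (upper (y 0))"
    and "exp (- (Im z + M) * x) * norm (upper (y 0)) \<le> norm (upper (y x))"
proof -
  have c: "\<bar>upper (y t) \<bullet> (v t *v lower (y t))\<bar> \<le> M * (norm (upper (y t)))\<^sup>2" if t: "t \<in> {0..l}" for t
  proof -
    have "M * norm (upper (y t)) * norm (lower (y t)) \<le> M * norm (upper (y t)) * norm (upper (y t))"
      using M_nonneg by (intro mult_left_mono cone t) auto
    then show ?thesis using coupling_bound[OF t, of "upper (y t)" "lower (y t)"] by (simp add: power2_eq_square mult.assoc)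
  qed
  show "norm (upper (y x)) \<le> exp (- (Im z - M) * x) * norm (upper (y 0))"
  proof -
    have "(norm (upper (y x)))\<^sup>2 \<le> exp ((2 * (- (Im z - M))) * (x - 0)) * (norm (upper (y 0)))\<^sup>2"
    proof (rule primitive_exp_bound[OF primitive_norm_upper[OF y]])
      fix t assume "t \<in> {0..l}"
      from c[OF this, THEN abs_le_D1] c[OF this, THEN abs_le_D2] show "2 * (- Im z * (norm (upper (y t)))\<^sup>2 + upper (y t) \<bullet> (v t *v lower (y t)))
          \<le> 2 * - (Im z - M) * (norm (upper (y t)))\<^sup>2" by argo
    qed (use x in auto)
    then show ?thesis by (rule sq_exp_bound) simp
  qed
  show "exp (- (Im z + M) * x) * norm (upper (y 0)) \<le> norm (upper (y x))"
  proof -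
    have "exp ((2 * (- (Im z + M))) * (x - 0)) * (norm (upper (y 0)))\<^sup>2 \<le> (norm (upper (y x)))\<^sup>2"
    proof (rule primitive_exp_lower_bound[OF primitive_norm_upper[OF y]])
      fix t assume "t \<in> {0..l}"
      from c[OF this, THEN abs_le_D1] c[OF this, THEN abs_le_D2] show "2 * - (Im z + M) * (norm (upper (y t)))\<^sup>2
          \<le> 2 * (- Im z * (norm (upper (y t)))\<^sup>2 + upper (y t) \<bullet> (v t *v lower (y t)))" by argo
    qed (use x in auto)
    then show ?thesis by (rule sq_exp_lower_bound) simp
  qed
qed

text \<open>The factor 2 separates this cone from |lower| \<le> |upper| by a definite margin, on
  which the splitting in \<open>norm_R_mult_weyl\<close> depends. Its price is 2M \<le> Im z: this
  makes the derivative of 4 |upper|^2 - |lower|^2 nonpositive.\<close>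

lemma upper_le_lower_forward:
  assumes y: "is_sol z y" and z: "2 * M \<le> Im z" and y0: "upper (y 0) = 0" and x: "x \<in> {0..l}"
  shows "2 * norm (upper (y x)) \<le> norm (lower (y x))"
proof -
  have "4 * (norm (upper (y x)))\<^sup>2 - (norm (lower (y x)))\<^sup>2 \<le> 4 * (norm (upper (y 0)))\<^sup>2 - (norm (lower (y 0)))\<^sup>2"
  proof (rule primitive_antimono[OF primitive_diff[OF primitive_bounded_linear[OF bounded_linear_mult_right primitive_norm_upper[OF y]] primitive_norm_lower[OF y]]])
    fix t assume t: "t \<in> {0..l}"
    let ?a = "norm (upper (y t))" and ?b = "norm (lower (y t))" and ?c = "upper (y t) \<bullet> (v t *v lower (y t))"
    have "2 * ?c \<le> 2 * M * (?a * ?b)" using coupling_bound[OF t, of "upper (y t)" "lower (y t)"] by (simp add: mult.assoc)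
    also have "\<dots> \<le> Im z * (?a * ?b)" using z by (intro mult_right_mono) auto
    finally have "10 * ?c - 2 * Im z * (4 * ?a\<^sup>2 + ?b\<^sup>2) \<le> - Im z * (2 * (2 * ?a - ?b)\<^sup>2 + 3 * (?a * ?b))"
      by (simp add: power2_eq_square algebra_simps)
    also have "\<dots> \<le> 0"
    proof -
      have "0 \<le> Im z * (2 * (2 * ?a - ?b)\<^sup>2 + 3 * (?a * ?b))" using z M_nonneg by (intro mult_nonneg_nonneg add_nonneg_nonneg) auto
      then show ?thesis by simp
    qed
    finally show "4 * (2 * (- Im z * ?a\<^sup>2 + ?c)) - 2 * (Im z * ?b\<^sup>2 - ?c) \<le> 0" by (simp add: algebra_simps)
  qed (use x in auto)
  also have "\<dots> \<le> 0" using y0 by simp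
  finally have "(2 * norm (upper (y x)))\<^sup>2 \<le> (norm (lower (y x)))\<^sup>2" by (simp add: power_mult_distrib)
  then show ?thesis by (rule power2_le_imp_le) simp
qed

lemma lower_exp_bounds:
  assumes y: "is_sol z y" and cone: "\<And>t. t \<in> {0..l} \<Longrightarrow> norm (upper (y t)) \<le> norm (lower (y t))" and x: "x \<in> {0..l}"
  shows "norm (lower (y x)) \<le> exp ((Im z + M) * x) * norm (lower (y 0))"
    and "exp ((Im z - M) * x) * norm (lower (y 0)) \<le> norm (lower (y x))"
proof -
  have c: "\<bar>upper (y t) \<bullet> (v t *v lower (y t))\<bar> \<le> M * (norm (lower (y t)))\<^sup>2" if t: "t \<in> {0..l}" for t
  proof -
    have "M * norm (upper (y t)) * norm (lower (y t)) \<le> M * norm (lower (y t)) * norm (lower (y t))"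
      using M_nonneg by (intro mult_right_mono mult_left_mono cone t) auto
    then show ?thesis using coupling_bound[OF t, of "upper (y t)" "lower (y t)"] by (simp add: power2_eq_square mult.assoc)
  qed
  show "norm (lower (y x)) \<le> exp ((Im z + M) * x) * norm (lower (y 0))"
  proof -
    have "(norm (lower (y x)))\<^sup>2 \<le> exp ((2 * (Im z + M)) * (x - 0)) * (norm (lower (y 0)))\<^sup>2"
    proof (rule primitive_exp_bound[OF primitive_norm_lower[OF y]])
      fix t assume "t \<in> {0..l}"
      from c[OF this, THEN abs_le_D1] c[OF this, THEN abs_le_D2] show "2 * (Im z * (norm (lower (y t)))\<^sup>2 - upper (y t) \<bullet> (v t *v lower (y t)))
          \<le> 2 * (Im z + M) * (norm (lower (y t)))\<^sup>2" by argo
    qed (use x in auto)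
    then show ?thesis by (rule sq_exp_bound) simp
  qed
  show "exp ((Im z - M) * x) * norm (lower (y 0)) \<le> norm (lower (y x))"
  proof -
    have "exp ((2 * (Im z - M)) * (x - 0)) * (norm (lower (y 0)))\<^sup>2 \<le> (norm (lower (y x)))\<^sup>2"
    proof (rule primitive_exp_lower_bound[OF primitive_norm_lower[OF y]])
      fix t assume "t \<in> {0..l}"
      from c[OF this, THEN abs_le_D1] c[OF this, THEN abs_le_D2] show "2 * (Im z - M) * (norm (lower (y t)))\<^sup>2
          \<le> 2 * (Im z * (norm (lower (y t)))\<^sup>2 - upper (y t) \<bullet> (v t *v lower (y t)))" by argo
    qed (use x in auto)
    then show ?thesis by (rule sq_exp_lower_bound) simp
  qed
qed

end

subsection \<open>Weyl functions\<close>

context dirac_potential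
begin

lemma u_inv: "x \<in> {0..l} \<Longrightarrow> matrix_inv (u z x) = ctranspose (u (cnj z) x)"
  by (intro matrix_inv_eqI u_unitary u_unitary')

text \<open>The formula for \<phi> says that [h; \<phi> h] is u(l)^-1 P k with k = T^-1 h, so u(l)
  maps it to P k, which lies in the cone. T is injective: if the upper part of u(l)^-1 P k vanishes,
  the backward cone property at 0 kills the lower part too, and then P^* P > 0 gives k = 0.\<close>

lemma weyl_cone_aux:
  fixes P :: "complex^'m1^('m1+'m2)" and \<phi> :: "complex^'m1^'m2"
  assumes z: "M \<le> Im z" and P: "pos_def (ctranspose P ** P)" "pos_semidef (ctranspose P ** sig_j ** P)"
    and \<phi>: "\<phi> = (block_row 0 (mat 1) ** matrix_inv (u z l) ** P)
       ** matrix_inv (block_row (mat 1) 0 ** matrix_inv (u z l) ** P)"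
  shows "norm (lower (u z l *v join h (\<phi> *v h))) \<le> norm (upper (u z l *v join h (\<phi> *v h)))"
proof -
  have l': "l \<in> {0..l}" using l by simp
  define W where "W = matrix_inv (u z l)"
  have uW: "u z l ** W = mat 1"
    using u_unitary'[OF l'] by (simp add: W_def u_inv[OF l'])
  define T where "T = block_row (mat 1) 0 ** W ** P"
  have T: "T *v k = upper (W *v (P *v k))" for k
    by (simp add: T_def block_row_mult flip: matrix_vector_mul_assoc)
  have cone: "norm (lower (P *v k)) \<le> norm (upper (P *v k))" for k
  proof -
    have "0 \<le> hform (ctranspose P ** sig_j ** P) k" using P(2) by (simp add: pos_semidef_def)
    also have "\<dots> = (P *v k) \<bullet> (sig_j *v (P *v k))"
      by (simp add: hform_eq_inner inner_matrix_vector_mult flip: matrix_vector_mul_assoc)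
    also have "\<dots> = (norm (upper (P *v k)))\<^sup>2 - (norm (lower (P *v k)))\<^sup>2"
      by (simp add: inner_upper_lower power2_norm_eq_inner)
    finally have "(norm (lower (P *v k)))\<^sup>2 \<le> (norm (upper (P *v k)))\<^sup>2" by simp
    then show ?thesis by (rule power2_le_imp_le) simp
  qed
  have uWP: "u z l *v (W *v (P *v k)) = P *v k" for k
    using uW by (simp add: matrix_vector_mul_assoc matrix_mul_assoc)
  have "T ** matrix_inv T = mat 1"
  proof (rule matrix_inv_right_of_injective)
    fix k assume "T *v k = 0"
    let ?y = "\<lambda>x. u z x *v (W *v (P *v k))"
    have "norm (lower (?y 0)) \<le> norm (upper (?y 0))"
      using lower_le_upper_backward[OF is_sol_u z, of "W *v (P *v k)" 0] cone l by (simp add: uWP)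
    then have "W *v (P *v k) = 0"
      using \<open>T *v k = 0\<close> by (intro upper_lower_eqI) (simp_all add: u(1) T)
    then have "P *v k = 0" using uWP[of k] by simp
    then have "hform (ctranspose P ** P) k = 0"
      by (simp add: hform_eq_inner flip: matrix_vector_mul_assoc)
    then show "k = 0" using P(1) unfolding pos_def_def by force
  qed
  then have "T *v (matrix_inv T *v h) = h" by (simp add: matrix_vector_mul_assoc)
  moreover have "\<phi> *v h = lower (W *v (P *v (matrix_inv T *v h)))"
    unfolding \<phi> W_def[symmetric] T_def[symmetric] by (simp add: block_row_mult flip: matrix_vector_mul_assoc)
  ultimately have "join h (\<phi> *v h) = W *v (P *v (matrix_inv T *v h))"
    by (intro upper_lower_eqI) (simp_all add: T)
  then show ?thesis by (simp add: uWP cone)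
qed

text \<open>Off the discrete exceptional set this is \<open>weyl_cone_aux\<close>. The inequality is
  closed, and \<phi> and \<open>u z l\<close> are continuous in z, so it survives at the exceptional
  points.\<close>

lemma weyl_cone:
  assumes \<phi>: "weyl_function M l v \<phi>" and z: "M < Im z"
  shows "norm (lower (u z l *v join h (\<phi> z *v h))) \<le> norm (upper (u z l *v join h (\<phi> z *v h)))"
proof -
  have l': "l \<in> {0..l}" using l by simp
  have zH: "z \<in> half_plane M" using z by (simp add: half_plane_def)
  have "open (half_plane M)" unfolding half_plane_def by (rule open_halfspace_Im_gt)
  from \<phi> obtain U P where an: "\<And>i k. (\<lambda>z. \<phi> z $ i $ k) analytic_on half_plane M"
    and P: "P \<in> P_ge M" and U: "\<And>z. z \<in> half_plane M \<Longrightarrow> fundamental_solution l v z (\<lambda>x. U x z)"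
    and ev: "\<forall>\<^sub>\<approx>z\<in>half_plane M. \<phi> z = (block_row 0 (mat 1) ** matrix_inv (U l z) ** P z)
                 ** matrix_inv (block_row (mat 1) 0 ** matrix_inv (U l z) ** P z)"
    unfolding weyl_function_def by blast
  define F where "F z = u z l *v join h (\<phi> z *v h)" for z
  have "\<forall>\<^sub>\<approx>z\<in>half_plane M. pos_def (ctranspose (P z) ** P z) \<and> pos_semidef (ctranspose (P z) ** sig_j ** P z)"
    using P by (simp add: P_ge_def)
  with ev have "\<forall>\<^sub>\<approx>z\<in>half_plane M. z \<in> half_plane M \<longrightarrow> norm (lower (F z)) \<le> norm (upper (F z))"
  proof eventually_elim
    case (elim w)
    show ?case
    proof
      assume w: "w \<in> half_plane M"
      then have "U l w = u w l" using fundamental_solution_eq_u[OF U l'] by simp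
      then show "norm (lower (F w)) \<le> norm (upper (F w))"
        using weyl_cone_aux[of w "P w" "\<phi> w" h] elim w unfolding F_def by (simp add: half_plane_def)
    qed
  qed
  then have "eventually (\<lambda>w. w \<in> half_plane M \<longrightarrow> norm (lower (F w)) \<le> norm (upper (F w))) (at z)"
    using eventually_cosparse_imp_eventually_at zH by blast
  moreover have "eventually (\<lambda>w. w \<in> half_plane M) (at z)"
    using \<open>open (half_plane M)\<close> zH eventually_at_in_open' by blast
  ultimately have "eventually (\<lambda>w. norm (lower (F w)) \<le> norm (upper (F w))) (at z)"
    by eventually_elim simp
  moreover have "(F \<longlongrightarrow> F z) (at z)"
  proof -
    have "(\<phi> \<longlongrightarrow> \<phi> z) (at z)"
    proof (intro vec_tendstoI)
      fix i k
      have "isCont (\<lambda>z. \<phi> z $ i $ k) z"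
        using analytic_on_imp_differentiable_at[OF an zH] by (rule field_differentiable_imp_continuous_at)
      then show "((\<lambda>z. \<phi> z $ i $ k) \<longlongrightarrow> \<phi> z $ i $ k) (at z)" by (simp add: isCont_def)
    qed
    moreover have "((\<lambda>z. u z l) \<longlongrightarrow> u z l) (at z)"
    proof (intro vec_tendstoI)
      fix i k
      have "isCont (\<lambda>z. u z l $ i $ k) z"
        using holomorphic_on_imp_continuous_on[OF u_holomorphic[OF l', of i k]]
        by (simp add: continuous_on_eq_continuous_at)
      then show "((\<lambda>z. u z l $ i $ k) \<longlongrightarrow> u z l $ i $ k) (at z)" by (simp add: isCont_def)
    qed
    ultimately show ?thesis
      unfolding F_def
      by (intro matvec.tendsto tendsto_join tendsto_const)
  qed
  ultimately show ?thesis
    unfolding F_def[symmetric]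
    by (intro tendsto_le[OF _ tendsto_norm[OF bounded_linear.tendsto[OF bounded_linear_upper]]
          tendsto_norm[OF bounded_linear.tendsto[OF bounded_linear_lower]]]) auto
qed

end

section \<open>The transfer matrix between two systems\<close>

locale dirac_pair = A: dirac_potential l M v + B: dirac_potential l M v'
  for l M :: real and v v' :: "real \<Rightarrow> complex^'m2::finite^'m1::finite"
begin

text \<open>The second factor is the inverse of \<open>A.u z x\<close>; in adjoint form its norm and
  its holomorphy in z can be read off.\<close>

definition R :: "complex \<Rightarrow> real \<Rightarrow> complex^('m1+'m2)^('m1+'m2)" where
  "R z x = B.u z x ** ctranspose (A.u (cnj z) x)"

lemma R_mult: "R z x *v h = B.u z x *v (ctranspose (A.u (cnj z) x) *v h)"
  by (simp add: R_def flip: matrix_vector_mul_assoc)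

text \<open>Serves three times: exponential type, the bound 1 on the real axis, and the bounded
  initial piece of the ray.\<close>

lemma norm_R_mult:
  assumes x: "x \<in> {0..l}"
  shows "norm (R z x *v h) \<le> exp (2 * \<bar>Im z\<bar> * x) * norm h"
proof -
  have "norm (R z x *v h) \<le> exp (\<bar>Im z\<bar> * x) * (exp (\<bar>Im z\<bar> * x) * norm h)"
    unfolding R_mult using A.norm_ctranspose_u_mult[OF x, of "cnj z" h]
    by (intro order_trans[OF B.norm_u_mult[OF x]] mult_left_mono) auto
  also have "\<dots> = exp (2 * \<bar>Im z\<bar> * x) * norm h"
    by (simp add: mult.assoc[symmetric] flip: exp_add)
  finally show ?thesis .
qed

lemma R_holomorphic:
  assumes x: "x \<in> {0..l}"
  shows "(\<lambda>z. (R z x *v h) $ i) holomorphic_on UNIV"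
  unfolding R_def matrix_vector_mult_def matrix_matrix_mult_def vec_lambda_beta
  by (intro holomorphic_intros B.u_holomorphic[OF x] A.ctranspose_u_holomorphic[OF x])

text \<open>A vector \<open>w\<close> is split as \<open>p + q\<close> with \<open>p\<close> in the range of the decaying (Weyl) solution and
  \<open>q\<close> in the range of the growing one; the two cones they lie in are uniformly transversal.\<close>

lemma norm_R_mult_weyl:
  assumes x: "x \<in> {0..l}" and z: "2 * M \<le> Im z"
    and \<phi>: "\<And>h. norm (lower (A.u z l *v join h (\<phi> *v h))) \<le> norm (upper (A.u z l *v join h (\<phi> *v h)))"
    and \<phi>': "\<And>h. norm (lower (B.u z l *v join h (\<phi>' *v h))) \<le> norm (upper (B.u z l *v join h (\<phi>' *v h)))"
    and C: "0 \<le> C" "opnorm (\<phi> - \<phi>') \<le> C * exp (- 2 * Im z * x)"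
  shows "norm (R z x *v w) \<le> (14 + 6 * C) * exp (2 * M * x) * norm w"
proof -
  have zM: "M \<le> Im z" using z A.M_nonneg by simp
  have "0 \<in> {0..l}" using x by auto
  define g where "g = ctranspose (A.u (cnj z) x) *v w"
  define a where "a = upper g"
  define b where "b = lower g - \<phi> *v a"
  define p where "p = A.u z x *v join a (\<phi> *v a)"
  define q where "q = A.u z x *v join 0 b"
  have g: "join a (\<phi> *v a) + join 0 b = g"
    by (rule upper_lower_eqI) (simp_all add: a_def b_def)
  have g': "join a (\<phi>' *v a) + join 0 (b + (\<phi> - \<phi>') *v a) = g"
    by (rule upper_lower_eqI) (simp_all add: a_def b_def matvec.diff_left)
  have w: "w = p + q"
    unfolding p_def q_def matvec.add_right[symmetric] g g_def using A.u_unitary'[OF x, of z]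
    by (simp add: matrix_vector_mul_assoc)
  let ?p = "\<lambda>t. A.u z t *v join a (\<phi> *v a)"
  let ?q = "\<lambda>t. A.u z t *v join 0 b"
  let ?p' = "\<lambda>t. B.u z t *v join a (\<phi>' *v a)"
  \<comment> \<open>The same initial vector g is split once with \<phi> for the first system and
    once with \<phi>' for the second; passing from one splitting to the other moves (\<phi> -
    \<phi>')a into the growing component.\<close>
  define c where "c = b + (\<phi> - \<phi>') *v a"
  let ?q' = "\<lambda>t. B.u z t *v join 0 c"
  have conep: "norm (lower (?p t)) \<le> norm (upper (?p t))" if "t \<in> {0..l}" for t
    by (rule A.lower_le_upper_backward[OF A.is_sol_u zM \<phi> that])
  have conep': "norm (lower (?p' t)) \<le> norm (upper (?p' t))" if "t \<in> {0..l}" for t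
    by (rule B.lower_le_upper_backward[OF B.is_sol_u zM \<phi>' that])
  have coneq: "2 * norm (upper (?q t)) \<le> norm (lower (?q t))" if "t \<in> {0..l}" for t
    by (rule A.upper_le_lower_forward[OF A.is_sol_u z _ that]) (simp add: A.u(1))
  have coneq': "2 * norm (upper (?q' t)) \<le> norm (lower (?q' t))" if "t \<in> {0..l}" for t
    by (rule B.upper_le_lower_forward[OF B.is_sol_u z _ that]) (simp add: B.u(1))
  have coneq1: "norm (upper (?q t)) \<le> norm (lower (?q t))" if "t \<in> {0..l}" for t
    using coneq[OF that] norm_ge_zero[of "upper (?q t)"] by linarith
  have coneq1': "norm (upper (?q' t)) \<le> norm (lower (?q' t))" if "t \<in> {0..l}" for t
    using coneq'[OF that] norm_ge_zero[of "upper (?q' t)"] by linarith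
  \<comment> \<open>Transversality: |upper p| \<le> |w| + |lower q|/2 and |lower q| \<le> |w| +
    |upper p|; solving the two inequalities gives the constants 3 and 4.\<close>
  have pq: "norm (upper p) \<le> 3 * norm w" "norm (lower q) \<le> 4 * norm w"
  proof -
    have "norm (upper p) - norm (upper q) \<le> norm w"
      using norm_diff_ineq[of "upper p" "upper q"] norm_upper_le[of w] by (simp add: w)
    moreover have "norm (lower q) - norm (lower p) \<le> norm w"
      using norm_diff_ineq[of "lower q" "lower p"] norm_lower_le[of w] by (simp add: w add.commute)
    moreover have "norm (lower p) \<le> norm (upper p)" "2 * norm (upper q) \<le> norm (lower q)"
      using conep[OF x] coneq[OF x] by (simp_all add: p_def q_def)
    ultimately show "norm (upper p) \<le> 3 * norm w" "norm (lower q) \<le> 4 * norm w" by linarith+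
  qed
  have a: "exp (- (Im z + M) * x) * norm a \<le> 3 * norm w"
    using A.upper_exp_bounds(2)[OF A.is_sol_u conep x] pq(1) by (simp add: A.u(1) p_def)
  have b: "exp ((Im z - M) * x) * norm b \<le> 4 * norm w"
    using A.lower_exp_bounds(2)[OF A.is_sol_u coneq1 x] pq(2) by (simp add: A.u(1) q_def)
  have p': "norm (?p' x) \<le> 2 * (exp (- (Im z - M) * x) * norm a)"
    using B.upper_exp_bounds(1)[OF B.is_sol_u conep' x] conep'[OF x] norm_le_upper_lower[of "?p' x"]
    by (simp add: B.u(1))
  have q': "norm (?q' x) \<le> 2 * (exp ((Im z + M) * x) * norm c)"
    using B.lower_exp_bounds(1)[OF B.is_sol_u coneq1' x] coneq1'[OF x] norm_le_upper_lower[of "?q' x"]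
    by (simp add: B.u(1))
  have c: "norm c \<le> norm b + C * exp (- 2 * Im z * x) * norm a"
    unfolding c_def
    by (intro norm_triangle_le add_left_mono order_trans[OF norm_mult_le_opnorm mult_right_mono[OF C(2)]]) auto
  let ?E = "exp (2 * M * x)"
  have "R z x *v w = ?p' x + ?q' x"
    unfolding R_mult c_def matvec.add_right[symmetric] g' g_def ..
  then have "norm (R z x *v w) \<le> 2 * (exp (- (Im z - M) * x) * norm a) + 2 * (exp ((Im z + M) * x) * norm c)"
    using norm_triangle_ineq[of "?p' x" "?q' x"] p' q' by simp
  also have "\<dots> \<le> 2 * (exp (- (Im z - M) * x) * norm a) + 2 * (exp ((Im z + M) * x) * (norm b + C * exp (- 2 * Im z * x) * norm a))"
    using c by (intro add_left_mono mult_left_mono) auto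
  \<comment> \<open>Here the rates cancel. Growth exp(Im z x) acting on (\<phi> - \<phi>')a meets
    the factor exp(-2 Im z x) of the hypothesis and |a|, which is at most of order exp(Im z x); only
    exp(2Mx) is left. In the end 14 = 2*3 + 2*4 and 6C = 2*3*C.\<close>
  also have "exp (- (Im z - M) * x) * norm a = ?E * (exp (- (Im z + M) * x) * norm a)"
  proof -
    have "exp (- (Im z - M) * x) = ?E * exp (- (Im z + M) * x)"
      unfolding exp_add[symmetric] by (simp add: algebra_simps)
    then show ?thesis by simp
  qed
  also have "exp ((Im z + M) * x) * (norm b + C * exp (- 2 * Im z * x) * norm a)
      = ?E * (exp ((Im z - M) * x) * norm b) + C * (?E * (exp (- (Im z + M) * x) * norm a))"
  proof -
    have e1: "exp ((Im z + M) * x) = ?E * exp ((Im z - M) * x)"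
      and e2: "exp ((Im z + M) * x) * exp (- 2 * Im z * x) = ?E * exp (- (Im z + M) * x)"
      unfolding exp_add[symmetric] by (simp_all add: algebra_simps)
    have "X * (r + C * D * s) = X * r + C * ((X * D) * s)" for X D r s :: real by algebra
    then have "exp ((Im z + M) * x) * (norm b + C * exp (- 2 * Im z * x) * norm a)
        = exp ((Im z + M) * x) * norm b + C * ((exp ((Im z + M) * x) * exp (- 2 * Im z * x)) * norm a)" .
    also have "\<dots> = (?E * exp ((Im z - M) * x)) * norm b + C * ((?E * exp (- (Im z + M) * x)) * norm a)"
      unfolding e2 unfolding e1 ..
    finally show ?thesis by (simp only: mult.assoc)
  qed
  also have "2 * (?E * (exp (- (Im z + M) * x) * norm a)) + 2 * (?E * (exp ((Im z - M) * x) * norm b)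
      + C * (?E * (exp (- (Im z + M) * x) * norm a))) \<le> 2 * (?E * (3 * norm w)) + 2 * (?E * (4 * norm w) + C * (?E * (3 * norm w)))"
    using a b C(1) by (intro add_mono mult_left_mono) auto
  also have "\<dots> = (14 + 6 * C) * ?E * norm w" by (simp add: algebra_simps)
  finally show ?thesis .
qed

end

subsection \<open>Local uniqueness\<close>

context dirac_pair
begin

text \<open>The exchanged pair, whose transfer matrix is the inverse of \<open>R\<close>; by
  \<open>R_cnj\<close> its bound on the ray is a bound for \<open>R\<close> on the conjugate
  ray.\<close>

interpretation S: dirac_pair l M v' v ..

lemma R_cnj: "R (cnj z) x = ctranspose (S.R z x)"
  by (simp add: R_def S.R_def ctranspose_matrix_mult)

lemma R_constant:
  assumes x: "x \<in> {0..l}" and \<phi>: "weyl_function M l v \<phi>" and \<phi>': "weyl_function M l v' \<phi>'"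
    and O: "(\<lambda>t::real. opnorm (\<phi> (Complex (c * t) t) - \<phi>' (Complex (c * t) t)))
             \<in> O[at_top](\<lambda>t. norm (exp (2 * \<i> * complex_of_real x * Complex (c * t) t)))"
  shows "R z x = R 0 x"
proof -
  obtain C where "0 < C" and "eventually (\<lambda>t::real. norm (opnorm (\<phi> (Complex (c * t) t) - \<phi>' (Complex (c * t) t)))
      \<le> C * norm (norm (exp (2 * \<i> * complex_of_real x * Complex (c * t) t)))) at_top"
    using O by (rule landau_o.bigE)
  then obtain T where "\<And>t. T \<le> t \<Longrightarrow> norm (opnorm (\<phi> (Complex (c * t) t) - \<phi>' (Complex (c * t) t)))
      \<le> C * norm (norm (exp (2 * \<i> * complex_of_real x * Complex (c * t) t)))"
    unfolding eventually_at_top_linorder by blast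
  then have T: "opnorm (\<phi> (Complex (c * t) t) - \<phi>' (Complex (c * t) t)) \<le> C * exp (- 2 * t * x)" if "T \<le> t" for t
    using that opnorm_nonneg by (fastforce simp: norm_exp_eq_Re mult_ac)
  \<comment> \<open>Beyond \<open>T'\<close> both the asymptotic hypothesis and the cone estimates
    are available; up to \<open>T'\<close> the growth bound exp(2 T' x) suffices. Their sum
    \<open>K\<close> is at least 1 and so covers the real axis too.\<close>
  define T' where "T' = max T (2 * M + 1)"
  define K where "K = (14 + 6 * C) * exp (2 * M * x) + exp (2 * T' * x)"
  have K1: "(14 + 6 * C) * exp (2 * M * x) \<le> K" and K2: "exp (2 * T' * x) \<le> K"
    using \<open>0 < C\<close> by (simp_all add: K_def)
  have "0 \<le> T'" using A.M_nonneg by (simp add: T'_def)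
  then have "1 \<le> K" using K2 x by (intro order_trans[OF _ K2]) simp
  have ray: "norm (R (Complex (c * t) t) x *v w) \<le> K * norm w" "norm (S.R (Complex (c * t) t) x *v w) \<le> K * norm w"
    if "0 < t" for t w
  proof -
    let ?z = "Complex (c * t) t"
    have "norm (R ?z x *v w) \<le> K * norm w \<and> norm (S.R ?z x *v w) \<le> K * norm w"
    proof (cases "t \<le> T'")
      case True
      then have "exp (2 * t * x) \<le> K" using x by (intro order_trans[OF _ K2]) (simp add: mult_right_mono)
      then have "exp (2 * \<bar>Im ?z\<bar> * x) * norm w \<le> K * norm w" using that by (intro mult_right_mono) auto
      then show ?thesis using norm_R_mult[OF x, of ?z w] S.norm_R_mult[OF x, of ?z w] by simp
    next
      case False
      then have z: "2 * M \<le> Im ?z" "M < Im ?z" and t: "T \<le> t" using A.M_nonneg by (auto simp: T'_def)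
      have d: "opnorm (\<phi> ?z - \<phi>' ?z) \<le> C * exp (- 2 * Im ?z * x)" using T[OF t] by simp
      note cones = A.weyl_cone[OF \<phi> z(2)] B.weyl_cone[OF \<phi>' z(2)]
      have "norm (R ?z x *v w) \<le> (14 + 6 * C) * exp (2 * M * x) * norm w"
        by (rule norm_R_mult_weyl[OF x z(1) cones _ d]) (use \<open>0 < C\<close> in simp)
      moreover have "norm (S.R ?z x *v w) \<le> (14 + 6 * C) * exp (2 * M * x) * norm w"
        by (rule S.norm_R_mult_weyl[OF x z(1) cones(2,1) _ d[unfolded opnorm_diff_commute[of "\<phi> ?z"]]]) (use \<open>0 < C\<close> in simp)
      ultimately show ?thesis using mult_right_mono[OF K1 norm_ge_zero[of w]] by linarith
    qed
    then show "norm (R ?z x *v w) \<le> K * norm w" "norm (S.R ?z x *v w) \<le> K * norm w" by auto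
  qed
  define \<theta> where "\<theta> = Arg (Complex c 1)"
  have \<theta>: "0 < \<theta>" "\<theta> < pi" using Arg_lt_pi[of "Complex c 1"] by (simp_all add: \<theta>_def)
  define n where "n = norm (Complex c 1)"
  have "0 < n" by (simp add: n_def complex_eq_iff)
  have rcis: "rcis r \<theta> = Complex (c * (r / n)) (r / n)" for r
  proof -
    have "rcis n \<theta> = Complex c 1" by (simp add: n_def \<theta>_def rcis_cmod_Arg)
    moreover have "rcis r \<theta> = of_real (r / n) * rcis n \<theta>" using \<open>0 < n\<close> by (simp add: rcis_def)
    ultimately show ?thesis by (simp add: complex_eq_iff)
  qed
  have rcis_minus: "rcis r (- \<theta>) = cnj (rcis r \<theta>)" for r by (simp add: complex_eq_iff)
  have "(R z x *v w) $ i = (R 0 x *v w) $ i" for w i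
  proof (rule entire_exp_type_bounded_on_rays_imp_constant[where f = "\<lambda>z. (R z x *v w) $ i"
        and C = "norm w" and B = "2 * x" and K = "K * norm w" and \<theta> = \<theta>])
    show "(\<lambda>z. (R z x *v w) $ i) holomorphic_on UNIV" by (rule R_holomorphic[OF x])
    show "norm ((R z x *v w) $ i) \<le> norm w * exp (2 * x * norm z)" for z
    proof -
      have "exp (2 * \<bar>Im z\<bar> * x) \<le> exp (2 * x * norm z)"
        using abs_Im_le_cmod[of z] x by (simp add: mult.commute mult_left_mono)
      then have "exp (2 * \<bar>Im z\<bar> * x) * norm w \<le> norm w * exp (2 * x * norm z)"
        by (subst mult.commute) (intro mult_left_mono, auto)
      then show ?thesis using norm_R_mult[OF x, of z w] Finite_Cartesian_Product.norm_nth_le[of "R z x *v w" i] by linarith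
    qed
    show "norm ((R (of_real t) x *v w) $ i) \<le> K * norm w" for t
    proof -
      have "norm (R (of_real t) x *v w) \<le> norm w" using norm_R_mult[OF x, of "of_real t" w] by simp
      also have "\<dots> \<le> K * norm w" using \<open>1 \<le> K\<close> mult_right_mono[of 1 K "norm w"] by simp
      finally show ?thesis using Finite_Cartesian_Product.norm_nth_le[of "R (of_real t) x *v w" i] by linarith
    qed
    fix r :: real assume "0 < r"
    then have t: "0 < r / n" using \<open>0 < n\<close> by simp
    show "norm ((R (rcis r \<theta>) x *v w) $ i) \<le> K * norm w"
      unfolding rcis by (rule order_trans[OF Finite_Cartesian_Product.norm_nth_le ray(1)[OF t]])
    have "norm (R (rcis r (- \<theta>)) x *v w) \<le> K * norm w"
      unfolding rcis_minus R_cnj rcis by (rule norm_adjoint_bound) (use \<open>1 \<le> K\<close> ray(2)[OF t] in auto)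
    then show "norm ((R (rcis r (- \<theta>)) x *v w) $ i) \<le> K * norm w"
      by (rule order_trans[OF Finite_Cartesian_Product.norm_nth_le])
  qed (use \<theta> x in auto)
  then show ?thesis by (intro matrix_eqI) (simp add: vec_eq_iff)
qed

lemma R_0 [simp]: "R z 0 = mat 1"
  by (simp add: R_def A.u(1) B.u(1))

lemma R_primitive:
  "primitive l (R z) (\<lambda>x. dirac_mat z (v' x) ** R z x - R z x ** dirac_mat z (v x))"
  using primitive_bilinear[OF bounded_bilinear_matrix_matrix_mult B.u(2)[of z]
      primitive_bounded_linear[OF bounded_linear_ctranspose A.u(2)[of "cnj z"]]]
  by (rule primitive_cong)
    (simp_all add: R_def ctranspose_matrix_mult ctranspose_dirac_mat matmat.minus_right matrix_mul_assoc)

lemma R_constant_imp_potentials_eq: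
  assumes r0: "0 < r0" "r0 \<le> l" and const: "\<And>z x. x \<in> {0..<r0} \<Longrightarrow> R z x = R 0 x"
  obtains N where "negligible N" "\<And>x. x \<in> {0<..<r0} - N \<Longrightarrow> v x = v' x"
proof -
  let ?Q = "R 0"
  define E where "E x = dirac_mat 0 (v' x) ** ?Q x - ?Q x ** dirac_mat 0 (v x)" for x
  \<comment> \<open>Since \<open>R z t\<close> equals \<open>?Q t\<close> for every z, one function
    satisfies the equations for all z; z = 0 and z = 1 carry all the information.\<close>
  have int: "((\<lambda>t. dirac_mat z (v' t) ** ?Q t - ?Q t ** dirac_mat z (v t)) has_integral ?Q x - mat 1) {0..x}"
    if x: "x \<in> {0..<r0}" for z x
  proof (rule has_integral_eq)
    have "((\<lambda>t. dirac_mat z (v' t) ** R z t - R z t ** dirac_mat z (v t)) has_integral R z x - R z 0) {0..x}"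
      using R_primitive[of z] x r0 unfolding primitive_def by auto
    then show "((\<lambda>t. dirac_mat z (v' t) ** R z t - R z t ** dirac_mat z (v t)) has_integral ?Q x - mat 1) {0..x}"
      unfolding const[OF x, of z] R_0 .
    show "dirac_mat z (v' t) ** R z t - R z t ** dirac_mat z (v t) = dirac_mat z (v' t) ** ?Q t - ?Q t ** dirac_mat z (v t)"
      if "t \<in> {0..x}" for t using const[of t z] that x by auto
  qed
  have intE: "(E has_integral ?Q x - mat 1) {0..x}" if "x \<in> {0..<r0}" for x
    using int[OF that, of 0] unfolding E_def .
  \<comment> \<open>The difference of the equations for z = 1 and z = 0 isolates the coefficient of
    z, the commutator of j with \<open>?Q\<close>.\<close>
  have "((\<lambda>t. mat \<i> ** (sig_j ** ?Q t - ?Q t ** sig_j)) has_integral 0) {0..x}" if "x \<in> {0..<r0}" for x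
  proof -
    have "(\<lambda>t. dirac_mat 1 (v' t) ** ?Q t - ?Q t ** dirac_mat 1 (v t) - E t)
        = (\<lambda>t. mat \<i> ** (sig_j ** ?Q t - ?Q t ** sig_j))"
      by (simp add: fun_eq_iff E_def dirac_mat_1_0 matmat.add_left matmat.add_right matmat.diff_right
          matrix_mul_assoc mat_commute[of \<i> "?Q _"])
    then show ?thesis using has_integral_diff[OF int[OF that, of 1] intE[OF that]] by simp
  qed
  note int0 = this
  have Q_cont: "continuous_on {0..l} ?Q" by (rule primitive_continuous[OF R_primitive])
  have comm: "sig_j ** ?Q x = ?Q x ** sig_j" if x: "x \<in> {0..<r0}" for x
  proof -
    \<comment> \<open>Constancy in z is known only for arguments below r0, while the continuity
      argument needs a nondegenerate closed interval containing x.\<close>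
    define b where "b = (x + r0) / 2"
    have b: "0 < b" "x \<in> {0..b}" "b < r0" using x r0 by (auto simp: b_def)
    have "mat \<i> ** (sig_j ** ?Q x - ?Q x ** sig_j) = 0"
    proof (rule continuous_has_integral_0[OF _ b(1) _ b(2)])
      show "continuous_on {0..b} (\<lambda>t. mat \<i> ** (sig_j ** ?Q t - ?Q t ** sig_j))"
        using b r0 by (intro matmat.continuous_on continuous_intros continuous_on_subset[OF Q_cont]) auto
    qed (use int0 b in auto)
    then have "mat (- \<i>) ** (mat \<i> ** (sig_j ** ?Q x - ?Q x ** sig_j)) = 0" by (simp add: matmat.zero_right)
    moreover have "mat (- \<i>) ** (mat \<i> ** A) = A" for A :: "complex^('m1+'m2)^('m1+'m2)"
      by (rule matrix_eqI) (simp add: mat_mult_vec vec_eq_iff flip: matrix_vector_mul_assoc)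
    ultimately show ?thesis by simp
  qed
  have Q1: "?Q x = mat 1" if x: "x \<in> {0..<r0}" for x
  proof -
    \<comment> \<open>Conjugation by j fixes \<open>?Q\<close> and negates \<open>E\<close>. Since
      ?Q x - 1 is the integral of \<open>E\<close>, it equals its own negative.\<close>
    have lin: "bounded_linear (\<lambda>A. sig_j ** A ** sig_j)"
      by (rule bounded_linear_compose[OF matmat.bounded_linear_left matmat.bounded_linear_right])
    have jj: "sig_j ** ?Q t ** sig_j = ?Q t" if "t \<in> {0..<r0}" for t
      using comm[OF that] by (simp add: matrix_mul_assoc[symmetric] sig_j_squared)
    have "((\<lambda>t. sig_j ** E t ** sig_j) has_integral sig_j ** (?Q x - mat 1) ** sig_j) {0..x}"
      using has_integral_linear[OF intE[OF x] lin] by (simp add: o_def)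
    moreover have "sig_j ** E t ** sig_j = - E t" if t: "t \<in> {0..x}" for t
    proof -
      have t': "t \<in> {0..<r0}" using t x by auto
      have "sig_j ** (dirac_mat 0 (v' t) ** ?Q t) ** sig_j = - (dirac_mat 0 (v' t) ** (sig_j ** ?Q t ** sig_j))"
        by (simp add: matrix_mul_assoc dirac_mat_anticommute matmat.minus_left)
      moreover have "sig_j ** (?Q t ** dirac_mat 0 (v t)) ** sig_j = ?Q t ** (sig_j ** dirac_mat 0 (v t) ** sig_j)"
        by (simp add: matrix_mul_assoc comm[OF t'])
      moreover have "sig_j ** dirac_mat 0 (v t) ** sig_j = - dirac_mat 0 (v t)"
        by (simp add: dirac_mat_anticommute matmat.minus_left sig_j_squared flip: matrix_mul_assoc)
      ultimately show ?thesis
        by (simp add: E_def matmat.diff_left matmat.diff_right matmat.minus_right jj[OF t'])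
    qed
    ultimately have "((\<lambda>t. - E t) has_integral sig_j ** (?Q x - mat 1) ** sig_j) {0..x}"
      by (rule has_integral_eq[rotated])
    moreover have "((\<lambda>t. - E t) has_integral - (?Q x - mat 1)) {0..x}"
      by (rule has_integral_neg[OF intE[OF x]])
    ultimately have "sig_j ** (?Q x - mat 1) ** sig_j = - (?Q x - mat 1)" by (rule has_integral_unique)
    then have "?Q x - mat 1 = - (?Q x - mat 1)"
      by (simp add: matmat.diff_left matmat.diff_right jj[OF x] sig_j_squared)
    then show ?thesis by (simp add: vec_eq_iff)
  qed
  have int1: "((\<lambda>t. dirac_mat 0 (v' t) - dirac_mat 0 (v t)) has_integral 0) {0..x}" if x: "x \<in> {0..<r0}" for x
  proof (rule has_integral_eq)
    show "(E has_integral 0) {0..x}" using intE[OF x] by (simp add: Q1[OF x])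
    show "E t = dirac_mat 0 (v' t) - dirac_mat 0 (v t)" if "t \<in> {0..x}" for t
      using Q1[of t] that x by (simp add: E_def)
  qed
  obtain N where "negligible N" and N: "\<And>x. x \<in> {0<..<r0} - N \<Longrightarrow> dirac_mat 0 (v' x) - dirac_mat 0 (v x) = 0"
    using has_integral_0_imp_negligible[OF int1] by metis
  moreover have "v x = v' x" if "x \<in> {0<..<r0} - N" for x
    using N[OF that] dirac_mat_inject[of 0 "v' x" "v x"] by simp
  ultimately show thesis using that by blast
qed

end

section \<open>Modification of the potential at the end points, and the conclusion\<close>

lemma fundamental_solution_cong:
  assumes "\<And>x. x \<in> {0<..<l} \<Longrightarrow> v x = w x"
  shows "fundamental_solution l v z y \<longleftrightarrow> fundamental_solution l w z y"
  unfolding fundamental_solution_def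
  by (intro conj_cong refl AE_cong) (simp add: space_restrict_space assms)

text \<open>The potential enters only through \<open>fundamental_solution\<close>, which tests the
  equation on the open interval.\<close>

lemma weyl_function_cong:
  assumes "\<And>x. x \<in> {0<..<l} \<Longrightarrow> v x = w x"
  shows "weyl_function M l v \<phi> \<longleftrightarrow> weyl_function M l w \<phi>"
  unfolding weyl_function_def by (simp only: fundamental_solution_cong[OF assms])

text \<open>The bound on the potential is only assumed on the open interval, so the potential is changed
  to \<open>0\<close> at the end points.\<close>

lemma dirac_potential_restrict:
  fixes v :: "real \<Rightarrow> complex^'m2::finite^'m1::finite"
  assumes "0 < l" "0 < M" and v: "bounded_measurable_potential l v"
    and "\<And>x. 0 < x \<Longrightarrow> x < l \<Longrightarrow> opnorm (v x) \<le> M"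
  shows "dirac_potential l M (\<lambda>x. if x \<in> {0<..<l} then v x else 0)"
proof
  let ?w = "\<lambda>x. if x \<in> {0<..<l} then v x else 0"
  show "?w \<in> borel_measurable (lebesgue_on {0..l})"
  proof (rule measurable_If_set)
    show "v \<in> borel_measurable (lebesgue_on {0..l})" using v by (simp add: bounded_measurable_potential_def)
    show "{0<..<l} \<inter> space (lebesgue_on {0..l}) \<in> sets (lebesgue_on {0..l})"
      by (auto simp: sets_restrict_space space_restrict_space intro!: image_eqI[of _ _ "{0<..<l}"])
  qed simp
  have "bounded (insert 0 (v ` {0..l}))" using v by (simp add: bounded_measurable_potential_def)
  then show "bounded (?w ` {0..l})" by (rule bounded_subset) auto
  show "opnorm (?w x) \<le> M" for x
    using assms by (auto simp: opnorm_def matvec.zero_left onorm_zero)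
qed fact

theorem theorem3p15:
  fixes l M c r0 :: real
    and v v' :: "real \<Rightarrow> complex^'m2::finite^'m1::finite"
    and \<phi> \<phi>' :: "complex \<Rightarrow> complex^'m1^'m2"
  assumes "0 < l" and "0 < M"
    and "bounded_measurable_potential l v"
    and "bounded_measurable_potential l v'"
    and "\<And>x. 0 < x \<Longrightarrow> x < l \<Longrightarrow> max (opnorm (v x)) (opnorm (v' x)) \<le> M"
    and "weyl_function M l v \<phi>"
    and "weyl_function M l v' \<phi>'"
    and "0 < r0" and "r0 \<le> l"
    and "\<And>r. 0 < r \<Longrightarrow> r < r0 \<Longrightarrow>
           (\<lambda>t::real. opnorm (\<phi> (Complex (c * t) t) - \<phi>' (Complex (c * t) t)))
             \<in> O[at_top](\<lambda>t. norm (exp (2 * \<i> * complex_of_real r * Complex (c * t) t)))"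
  shows "AE x in lebesgue_on {0<..<r0}. v x = v' x"
proof -
  define w where "w x = (if x \<in> {0<..<l} then v x else 0)" for x
  define w' where "w' x = (if x \<in> {0<..<l} then v' x else 0)" for x
  interpret dirac_pair l M w w'
    unfolding dirac_pair_def w_def[abs_def] w'_def[abs_def]
    using assms(1-5) by (intro conjI dirac_potential_restrict) auto
  have \<phi>: "weyl_function M l w \<phi>" and \<phi>': "weyl_function M l w' \<phi>'"
    using assms(6,7) weyl_function_cong[of l v w] weyl_function_cong[of l v' w'] by (auto simp: w_def w'_def)
  \<comment> \<open>The growth hypothesis is applied with r = x. The value x = 0 is not an
    admissible r, but there \<open>R\<close> is the identity.\<close>
  have "R z x = R 0 x" if x: "x \<in> {0..<r0}" for z x
  proof (cases "x = 0")
    case False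
    with x assms(9) show ?thesis by (intro R_constant[OF _ \<phi> \<phi>' assms(10)]) auto
  qed simp
  then obtain N where N: "negligible N" "\<And>x. x \<in> {0<..<r0} - N \<Longrightarrow> w x = w' x"
    using R_constant_imp_potentials_eq[OF assms(8,9)] by metis
  have "AE x in lebesgue. x \<notin> N"
    using N(1) AE_not_in by (auto simp: negligible_iff_null_sets)
  then have "AE x in lebesgue. x \<in> {0<..<r0} \<longrightarrow> v x = v' x"
    by eventually_elim (use N(2) assms(9) in \<open>force simp: w_def w'_def\<close>)
  then show ?thesis by (simp add: AE_restrict_space_iff)
qed

end
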